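(* Let $G\le\mathrm{Sym}(\Delta)\wr\mathrm{Sym}(\Omega)$ (with $|\Omega|=r$, product action on $\Delta^r$) be a primitive group of product action type, and let $T$ be the socle of $G_\Delta^\Delta$. Suppose that $T$ and $G_\Delta^\Delta$ have the same orbital digraphs on $\Delta$. Then the orbital digraphs of $G$ on $\Delta^r$ coincide with the orbital digraphs of $G_\Delta^\Delta\wr G^\Omega$, or equivalently of $T\wr G^\Omega$, in product action on $\Delta^r$.
   Context: Identify $\Omega$ with $\{1,\ldots,r\}$. Product action: $K\wr H=K^r\rtimes H$ acts on $\Delta^r$ by $(\delta_1,\ldots,\delta_r)^{(k_1,\ldots,k_r)h}=(\delta_{1h^{-1}}^{k_{1h^{-1}}},\ldots,\delta_{rh^{-1}}^{k_{rh^{-1}}})$. Every element of $G$ is uniquely $gh$ with $g=(k_1,\ldots,k_r)\in\mathrm{Sym}(\Delta)^r$ and $h\in\mathrm{Sym}(\Omega)$; $G^\Omega$ is the image of the homomorphism $gh\mapsto h$. Identifying $\delta\in\Delta$ with the block $\{\delta\}\times\Delta^{r-1}$, $G_\Delta$ is the stabilizer in $G$ of this system of blocks (the elements with $1h=1$), and $G_\Delta^\Delta\cong G_\Delta/G_{(\Delta)}$ is the permutation group it induces on $\Delta$. $G$ is primitive of product action type if it is primitive and there exist a transitive $H\le\mathrm{Sym}(\Omega)$, a primitive almost simple $K\le\mathrm{Sym}(\Delta)$ with socle $T$, and $r\ge2$, such that $T^r\le G\le K\wr H$ and $T^r$ is the socle of $G$. An orbital digraph of a permutation group on a set $\Omega'$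 has vertex-set $\Omega'$ and arc-set an orbit of the group on $\Omega'\times\Omega'$.
   Formalization: As stated the claim can fail; the formal theorem claims it for G when G ≤ G_Δ^Δ wr G^Ω, and otherwise for every conjugate of G by an element of Sym(Δ)^r with trivial first coordinate lying in that wreath product, proving that such a conjugate always exists. *)

theory Defs
  imports
    "HOL-Algebra.Generated_Groups"
    "HOL-Algebra.Group_Action"
    "HOL-Library.Disjoint_Sets"
    "Graph_Theory.Pair_Digraph"
begin

section \<open>Permutation groups\<close>

text \<open>
  A permutation group on \<open>X\<close> is a set \<open>G\<close> with \<open>subgroup G (BijGroup X)\<close>. Multiplication in
  \<open>BijGroup X\<close> is composition from right to left, whereas exponent notation for permutations
  multiplies from left to right. The two groups are opposite to each other, so that they have
  the same subgroups, normal subgroups, socle and orbits.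
\<close>

abbreviation perm_group :: "'a set \<Rightarrow> ('a \<Rightarrow> 'a) set \<Rightarrow> ('a \<Rightarrow> 'a) monoid" where
  "perm_group X G \<equiv> BijGroup X \<lparr>carrier := G\<rparr>"

abbreviation transitive_on :: "'a set \<Rightarrow> ('a \<Rightarrow> 'a) set \<Rightarrow> bool" where
  "transitive_on X G \<equiv> transitive_action (perm_group X G) X (\<lambda>g. g)"

definition primitive_on :: "'a set \<Rightarrow> ('a \<Rightarrow> 'a) set \<Rightarrow> bool" where
  "primitive_on X G \<longleftrightarrow>
     transitive_on X G \<and>
     (\<forall>P. partition_on X P \<and> (\<forall>g\<in>G. \<forall>B\<in>P. g ` B \<in> P)
        \<longrightarrow> P = {X} \<or> P = (\<lambda>x. {x}) ` X)"

definition orbital_digraphs :: "'a set \<Rightarrow> ('a \<Rightarrow> 'a) set \<Rightarrow> 'a pair_pre_digraph set" where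
  "orbital_digraphs X G =
     (\<lambda>A. \<lparr>pverts = X, parcs = A\<rparr>) ` orbits (perm_group X G) (X \<times> X) (\<lambda>g. map_prod g g)"


section \<open>Socle and almost simple groups\<close>

definition minimal_normal :: "('a, 'b) monoid_scheme \<Rightarrow> 'a set \<Rightarrow> bool" where
  "minimal_normal G N \<longleftrightarrow>
     N \<lhd> G \<and> N \<noteq> {\<one>\<^bsub>G\<^esub>} \<and> (\<forall>M. M \<lhd> G \<and> M \<subseteq> N \<and> M \<noteq> {\<one>\<^bsub>G\<^esub>} \<longrightarrow> M = N)"

definition socle :: "('a, 'b) monoid_scheme \<Rightarrow> 'a set" where
  "socle G = generate G (\<Union>{N. minimal_normal G N})"

text \<open>
  The locale \<open>simple_group\<close> of HOL-Algebra assumes \<open>order G > 1\<close>, which excludes infinite groups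
  because \<open>order\<close> is a \<open>card\<close>. No finiteness is built in here.
\<close>

definition nonabelian_simple :: "('a, 'b) monoid_scheme \<Rightarrow> bool" where
  "nonabelian_simple S \<longleftrightarrow>
     group S \<and> \<not> comm_group S \<and> (\<forall>N. N \<lhd> S \<longrightarrow> N = carrier S \<or> N = {\<one>\<^bsub>S\<^esub>})"

definition inner_auto :: "('a, 'b) monoid_scheme \<Rightarrow> ('a \<Rightarrow> 'a) set" where
  "inner_auto S = (\<lambda>a. \<lambda>s\<in>carrier S. a \<otimes>\<^bsub>S\<^esub> s \<otimes>\<^bsub>S\<^esub> inv\<^bsub>S\<^esub> a) ` carrier S"

text \<open>
  \<open>K\<close> is almost simple if it is, up to isomorphism, a group between \<open>Inn S\<close> and \<open>Aut S\<close> for some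
  nonabelian simple group \<open>S\<close>. Such an \<open>S\<close> embeds in \<open>K\<close>, so it is no restriction that its
  elements have the same type as those of \<open>K\<close>.
\<close>

definition almost_simple :: "'a monoid \<Rightarrow> bool" where
  "almost_simple K \<longleftrightarrow>
     (\<exists>(S :: 'a monoid) A. nonabelian_simple S \<and> subgroup A (AutoGroup S) \<and>
        inner_auto S \<subseteq> A \<and> K \<cong> AutoGroup S \<lparr>carrier := A\<rparr>)"


section \<open>Wreath products in product action\<close>

abbreviation tuples :: "nat \<Rightarrow> 'a set \<Rightarrow> (nat \<Rightarrow> 'a) set" where
  "tuples r D \<equiv> {1..r} \<rightarrow>\<^sub>E D"

text \<open>
  The permutation of \<open>D\<^sup>r\<close> induced by \<open>(k\<^sub>1,\<dots>,k\<^sub>r)h\<close>. If \<open>D\<close> has at least two elements, then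
  \<open>k\<close> and \<open>h\<close> are determined by this permutation, and wreath products can be identified with
  the permutation groups they induce on \<open>D\<^sup>r\<close>.
\<close>

definition product_action ::
  "nat \<Rightarrow> 'a set \<Rightarrow> (nat \<Rightarrow> 'a \<Rightarrow> 'a) \<Rightarrow> (nat \<Rightarrow> nat) \<Rightarrow> (nat \<Rightarrow> 'a) \<Rightarrow> (nat \<Rightarrow> 'a)" where
  "product_action r D k h =
     (\<lambda>x\<in>tuples r D. \<lambda>i\<in>{1..r}. let j = inv_into {1..r} h i in k j (x j))"

definition wreath ::
  "nat \<Rightarrow> 'a set \<Rightarrow> ('a \<Rightarrow> 'a) set \<Rightarrow> (nat \<Rightarrow> nat) set \<Rightarrow> ((nat \<Rightarrow> 'a) \<Rightarrow> (nat \<Rightarrow> 'a)) set" where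
  "wreath r D K H = {product_action r D k h | k h. k \<in> {1..r} \<rightarrow>\<^sub>E K \<and> h \<in> H}"

definition base_power ::
  "nat \<Rightarrow> 'a set \<Rightarrow> ('a \<Rightarrow> 'a) set \<Rightarrow> ((nat \<Rightarrow> 'a) \<Rightarrow> (nat \<Rightarrow> 'a)) set" where
  "base_power r D K = {product_action r D k (\<lambda>i\<in>{1..r}. i) | k. k \<in> {1..r} \<rightarrow>\<^sub>E K}"

definition top_image ::
  "nat \<Rightarrow> 'a set \<Rightarrow> ((nat \<Rightarrow> 'a) \<Rightarrow> (nat \<Rightarrow> 'a)) set \<Rightarrow> (nat \<Rightarrow> nat) set" where
  "top_image r D G =
     {h \<in> Bij {1..r}. \<exists>k \<in> {1..r} \<rightarrow>\<^sub>E Bij D. product_action r D k h \<in> G}"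

text \<open>The block \<open>{d} \<times> D\<^sup>r\<^sup>-\<^sup>1\<close>.\<close>

definition block :: "nat \<Rightarrow> 'a set \<Rightarrow> 'a \<Rightarrow> (nat \<Rightarrow> 'a) set" where
  "block r D d = {x \<in> tuples r D. x 1 = d}"

definition block_stabilizer ::
  "nat \<Rightarrow> 'a set \<Rightarrow> ((nat \<Rightarrow> 'a) \<Rightarrow> (nat \<Rightarrow> 'a)) set \<Rightarrow> ((nat \<Rightarrow> 'a) \<Rightarrow> (nat \<Rightarrow> 'a)) set" where
  "block_stabilizer r D G = {g \<in> G. (\<lambda>B. g ` B) ` (block r D ` D) = block r D ` D}"

definition component ::
  "nat \<Rightarrow> 'a set \<Rightarrow> ((nat \<Rightarrow> 'a) \<Rightarrow> (nat \<Rightarrow> 'a)) set \<Rightarrow> ('a \<Rightarrow> 'a) set" where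
  "component r D G =
     {s \<in> Bij D. \<exists>g\<in>block_stabilizer r D G. \<forall>d\<in>D. g ` block r D d = block r D (s d)}"

definition product_action_type ::
  "nat \<Rightarrow> 'a set \<Rightarrow> ((nat \<Rightarrow> 'a) \<Rightarrow> (nat \<Rightarrow> 'a)) set \<Rightarrow> bool" where
  "product_action_type r D G \<longleftrightarrow>
     subgroup G (BijGroup (tuples r D)) \<and> primitive_on (tuples r D) G \<and> r \<ge> 2 \<and>
     (\<exists>H K. subgroup H (BijGroup {1..r}) \<and> transitive_on {1..r} H \<and>
        subgroup K (BijGroup D) \<and> primitive_on D K \<and> almost_simple (perm_group D K) \<and>
        (let T = socle (perm_group D K) in
           base_power r D T \<subseteq> G \<and> G \<subseteq> wreath r D K H \<and>
           socle (perm_group (tuples r D) G) = base_power r D T))"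

text \<open>
  A group \<open>G\<close> of product action type need not be contained in \<open>component r D G wr top_image r D G\<close>,
  but it is after relabelling the second to last coordinates by suitable permutations of \<open>D\<close>.
  Such a relabelling \<open>u\<close> does not change \<open>component r D G\<close> and \<open>top_image r D G\<close>.
\<close>

definition relabellings ::
  "nat \<Rightarrow> 'a set \<Rightarrow> ((nat \<Rightarrow> 'a) \<Rightarrow> (nat \<Rightarrow> 'a)) set" where
  "relabellings r D =
     {product_action r D k (\<lambda>i\<in>{1..r}. i) | k. k \<in> {1..r} \<rightarrow>\<^sub>E Bij D \<and> k 1 = (\<lambda>d\<in>D. d)}"

definition conjugate :: "'a set \<Rightarrow> ('a \<Rightarrow> 'a) \<Rightarrow> ('a \<Rightarrow> 'a) set \<Rightarrow> ('a \<Rightarrow> 'a) set" where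
  "conjugate X u G = (\<lambda>g. u \<otimes>\<^bsub>BijGroup X\<^esub> g \<otimes>\<^bsub>BijGroup X\<^esub> inv\<^bsub>BijGroup X\<^esub> u) ` G"

end

theory Submission
  imports Defs
begin

text \<open>
  Write \<open>N\<close> for the socle of the almost simple group \<open>K\<close>. It is simple, normal in \<open>K\<close> and has
  trivial centralizer there, so it is also the socle of every group between \<open>N\<close> and \<open>K\<close>. The
  component \<open>L\<close> is such a group, hence \<open>T = N\<close> and \<open>T\<^sup>r \<le> G\<close>. Suppose that \<open>G \<le> L wr P\<close>. For a pair
  of tuples and an element \<open>kh\<close> of \<open>L wr P\<close>, choose \<open>k'h\<close> in \<open>G\<close>; in each coordinate \<open>k\<close> and \<open>k'\<close>
  differ by an element of \<open>L\<close>, which on the pair of entries in question acts like an element of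
  \<open>T\<close>. Since \<open>T\<^sup>r \<le> G\<close>, some element of \<open>G\<close> acts on the pair like \<open>kh\<close>. The same argument
  applies to \<open>T wr P\<close>.

  Primitivity makes \<open>P\<close> transitive on the coordinates, and elements of \<open>G\<close> which move the first
  coordinate to the others provide the relabelling into \<open>L wr P\<close>. Conversely, the coordinates of
  any such relabelling lie in \<open>K\<close> and therefore normalize \<open>T\<close>, so that the conjugate of \<open>G\<close> still
  contains \<open>T\<^sup>r\<close>.
\<close>

subsection \<open>The socle of an almost simple group\<close>

text \<open>Moves normality from the group with restricted carrier to the operations of the ambient
  group, where subgroups of different intermediate groups can be compared.\<close>

lemma (in group) normal_in_subgroup_iff:
  assumes "subgroup H G"
  shows "N \<lhd> G\<lparr>carrier := H\<rparr> \<longleftrightarrow>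
    subgroup N G \<and> N \<subseteq> H \<and> (\<forall>x\<in>H. \<forall>n\<in>N. x \<otimes> n \<otimes> inv x \<in> N)"
proof -
  interpret H: group "G\<lparr>carrier := H\<rparr>"
    by (rule subgroup_imp_group[OF assms])
  have "subgroup N (G\<lparr>carrier := H\<rparr>) \<longleftrightarrow> subgroup N G \<and> N \<subseteq> H"
    using incl_subgroup[OF assms] subgroup_incl[OF _ assms] subgroup.subset
    by fastforce
  then show ?thesis
    using m_inv_consistent[OF assms] by (auto simp: H.normal_inv_iff)
qed

text \<open>The last three conjuncts are normality in \<open>K\<close>, simplicity of
  \<open>N\<close>, and triviality of the centralizer of \<open>N\<close> in \<open>K\<close>.
  Everything is phrased with the operations of the ambient group, so that \<open>K\<close> can be
  replaced by a smaller group while \<open>N\<close> stays literally the same set.\<close>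

definition (in group) socle_witness :: "'a set \<Rightarrow> 'a set \<Rightarrow> bool" where
  "socle_witness N K \<longleftrightarrow>
     subgroup N G \<and> N \<subseteq> K \<and> N \<noteq> {\<one>} \<and>
     (\<forall>x\<in>K. \<forall>n\<in>N. x \<otimes> n \<otimes> inv x \<in> N) \<and>
     (\<forall>M. subgroup M G \<and> M \<subseteq> N \<and> (\<forall>x\<in>N. \<forall>m\<in>M. x \<otimes> m \<otimes> inv x \<in> M)
        \<longrightarrow> M = N \<or> M = {\<one>}) \<and>
     (\<forall>x\<in>K. (\<forall>n\<in>N. x \<otimes> n = n \<otimes> x) \<longrightarrow> x = \<one>)"

text \<open>\<open>K\<close> enters only as an upper bound of \<open>N\<close> and as the range of
  universal quantifiers. This is how the socle of \<open>K\<close> becomes the socle of the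
  component.\<close>

lemma (in group) socle_witness_mono:
  "socle_witness N K \<Longrightarrow> N \<subseteq> L \<Longrightarrow> L \<subseteq> K \<Longrightarrow> socle_witness N L"
  by (simp add: socle_witness_def subset_iff)

text \<open>\<open>N\<close> lies in every nontrivial normal subgroup \<open>M\<close>. If
  \<open>M\<close> meets \<open>N\<close> nontrivially, the intersection is all of \<open>N\<close>
  by simplicity; if not, \<open>M\<close> and \<open>N\<close> commute elementwise, so
  \<open>M\<close> lies in the trivial centralizer.\<close>

lemma (in group) minimal_normal_iff_socle_witness:
  assumes K: "subgroup K G" and N: "socle_witness N K"
  shows "minimal_normal (G\<lparr>carrier := K\<rparr>) M \<longleftrightarrow> M = N"
proof -
  have NG: "subgroup N G" and NK: "N \<subseteq> K" and N1: "N \<noteq> {\<one>}"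
    and Nc: "\<forall>x\<in>K. \<forall>n\<in>N. x \<otimes> n \<otimes> inv x \<in> N"
    and Ns: "\<forall>M. subgroup M G \<and> M \<subseteq> N \<and> (\<forall>x\<in>N. \<forall>m\<in>M. x \<otimes> m \<otimes> inv x \<in> M)
        \<longrightarrow> M = N \<or> M = {\<one>}"
    and Nz: "\<forall>x\<in>K. (\<forall>n\<in>N. x \<otimes> n = n \<otimes> x) \<longrightarrow> x = \<one>"
    using N by (simp_all add: socle_witness_def)
  have KG: "K \<subseteq> carrier G" using K subgroup.subset by blast
  \<comment> \<open>Normality in \<open>K\<close> includes invariance under conjugation by
    \<open>N\<close>, so simplicity of \<open>N\<close> applies to \<open>M\<close>.\<close>
  have normal_sub: "M = N" if "M \<lhd> G\<lparr>carrier := K\<rparr>" "M \<subseteq> N" "M \<noteq> {\<one>}" for M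
  proof -
    have "subgroup M G" "\<forall>x\<in>N. \<forall>m\<in>M. x \<otimes> m \<otimes> inv x \<in> M"
      using that(1) NK unfolding normal_in_subgroup_iff[OF K] by auto
    with Ns[rule_format, of M] that show ?thesis by simp
  qed
  have normal_N: "N \<lhd> G\<lparr>carrier := K\<rparr>"
    using NG NK Nc unfolding normal_in_subgroup_iff[OF K] by simp
  have le: "N \<subseteq> M" if M: "M \<lhd> G\<lparr>carrier := K\<rparr>" "M \<noteq> {\<one>}" for M
  proof -
    have MG: "subgroup M G" "M \<subseteq> K"
      using M(1) unfolding normal_in_subgroup_iff[OF K] by blast+
    have Mc: "x \<otimes> m \<otimes> inv x \<in> M" if "x \<in> K" "m \<in> M" for x m
      using M(1) that unfolding normal_in_subgroup_iff[OF K] by blast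
    have I: "M \<inter> N \<lhd> G\<lparr>carrier := K\<rparr>"
      unfolding normal_in_subgroup_iff[OF K]
    proof (intro conjI ballI)
      show "subgroup (M \<inter> N) G" using subgroups_Inter_pair[of M N] MG(1) NG by simp
      show "M \<inter> N \<subseteq> K" using MG(2) by blast
      fix x m assume "x \<in> K" "m \<in> M \<inter> N"
      then show "x \<otimes> m \<otimes> inv x \<in> M \<inter> N" using Mc Nc by simp
    qed
    show ?thesis
    proof (cases "M \<inter> N = {\<one>}")
      case False
      then show ?thesis using normal_sub[OF I] by blast
    next
      case True
      have "m = \<one>" if m: "m \<in> M" for m
      proof -
        have "m \<otimes> n = n \<otimes> m" if n: "n \<in> N" for n
        proof -
          have c: "m \<in> carrier G" "n \<in> carrier G" using m n MG(2) NK KG by auto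
          have im: "inv m \<in> M" "inv n \<in> N"
            using subgroup.m_inv_closed[OF MG(1) m] subgroup.m_inv_closed[OF NG n] .
          \<comment> \<open>The commutator of \<open>m\<close> and \<open>n\<close> lies in
            \<open>M\<close>, as \<open>m\<close> times a conjugate of \<open>inv m\<close>, and in
            \<open>N\<close>, as a conjugate of \<open>n\<close> times \<open>inv n\<close>.\<close>
          have "n \<otimes> inv m \<otimes> inv n \<in> M" using Mc[OF _ im(1)] n NK by auto
          then have "m \<otimes> (n \<otimes> inv m \<otimes> inv n) \<in> M"
            by (rule subgroup.m_closed[OF MG(1) m])
          then have 1: "m \<otimes> n \<otimes> inv m \<otimes> inv n \<in> M" using c by (simp add: m_assoc)
          have "m \<otimes> n \<otimes> inv m \<in> N" using Nc m n MG(2) by auto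
          then have "m \<otimes> n \<otimes> inv m \<otimes> inv n \<in> N"
            by (rule subgroup.m_closed[OF NG _ im(2)])
          with 1 True have "m \<otimes> n \<otimes> inv m \<otimes> inv n = \<one>" by blast
          then have "(m \<otimes> n) \<otimes> inv (n \<otimes> m) = \<one>"
            using c by (simp add: m_assoc inv_mult_group)
          then show ?thesis using c
            by (metis inv_equality inv_inv m_closed inv_closed)
        qed
        then show ?thesis using Nz m MG(2) by auto
      qed
      then have "M \<subseteq> {\<one>}" by (intro subsetI) simp
      then have "M = {\<one>}" using subgroup.one_closed[OF MG(1)] by blast
      then show ?thesis using M by blast
    qed
  qed
  show ?thesis
  proof
    assume "M = N"
    then show "minimal_normal (G\<lparr>carrier := K\<rparr>) M"
      using normal_N normal_sub N1 by (auto simp: minimal_normal_def)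
  next
    assume "minimal_normal (G\<lparr>carrier := K\<rparr>) M"
    then have "M \<lhd> G\<lparr>carrier := K\<rparr>" "M \<noteq> {\<one>}"
      "\<And>M'. M' \<lhd> G\<lparr>carrier := K\<rparr> \<Longrightarrow> M' \<subseteq> M \<Longrightarrow> M' \<noteq> {\<one>} \<Longrightarrow> M' = M"
      by (auto simp: minimal_normal_def)
    then show "M = N" using le normal_N N1 by metis
  qed
qed

lemma (in group) socle_eq_socle_witness:
  assumes K: "subgroup K G" and N: "socle_witness N K"
  shows "socle (G\<lparr>carrier := K\<rparr>) = N"
proof -
  interpret K: group "G\<lparr>carrier := K\<rparr>"
    by (rule subgroup_imp_group[OF K])
  have "subgroup N (G\<lparr>carrier := K\<rparr>)"
    using N subgroup_incl[OF _ K] by (auto simp: socle_witness_def)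
  then have "generate (G\<lparr>carrier := K\<rparr>) N = N"
    using K.generate_subgroup_incl[of N N] generate.incl[of _ N] by blast
  moreover have "{M. minimal_normal (G\<lparr>carrier := K\<rparr>) M} = {N}"
    using minimal_normal_iff_socle_witness[OF K N] by auto
  ultimately show ?thesis by (simp add: socle_def)
qed

text \<open>Here \<open>K\<close> acts by conjugation on an embedded copy of \<open>S\<close>, and
  \<open>\<alpha> k\<close> is this action read in \<open>S\<close>. An element that centralizes the
  copy acts trivially because \<open>\<psi>\<close> is injective, and is the identity because the
  action is faithful; the other requirements are pulled back to \<open>S\<close>.\<close>

lemma (in group) socle_witness_image:
  assumes K: "subgroup K G" and S: "nonabelian_simple S"
    and \<psi>: "\<psi> \<in> hom S G" and sub: "\<psi> ` carrier S \<subseteq> K" and inj: "inj_on \<psi> (carrier S)"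
    and \<alpha>: "\<And>k s. k \<in> K \<Longrightarrow> s \<in> carrier S \<Longrightarrow>
      \<alpha> k s \<in> carrier S \<and> k \<otimes> \<psi> s \<otimes> inv k = \<psi> (\<alpha> k s)"
    and faithful: "\<And>k. k \<in> K \<Longrightarrow> (\<And>s. s \<in> carrier S \<Longrightarrow> \<alpha> k s = s) \<Longrightarrow> k = \<one>"
  shows "socle_witness (\<psi> ` carrier S) K"
proof -
  interpret S: group S using S by (simp add: nonabelian_simple_def)
  interpret \<psi>: group_hom S G \<psi>
    using \<psi> by (simp add: group_hom_def group_hom_axioms_def S.group_axioms group_axioms)
  have KG: "K \<subseteq> carrier G" using K subgroup.subset by blast
  show ?thesis
    unfolding socle_witness_def
  proof (intro conjI allI impI ballI)
    show "subgroup (\<psi> ` carrier S) G" by (rule \<psi>.img_is_subgroup)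
    show "\<psi> ` carrier S \<subseteq> K" by (rule sub)
    show "\<psi> ` carrier S \<noteq> {\<one>}"
    proof
      \<comment> \<open>By injectivity \<open>S\<close> would be trivial, hence commutative.\<close>
      assume eq: "\<psi> ` carrier S = {\<one>}"
      have "s = \<one>\<^bsub>S\<^esub>" if "s \<in> carrier S" for s
      proof (rule inj_onD[OF inj _ that])
        show "\<psi> s = \<psi> \<one>\<^bsub>S\<^esub>" using eq that by auto
      qed simp
      then have "comm_group S"
        using S.group_axioms by (intro S.group_comm_groupI) (metis)
      then show False using S by (simp add: nonabelian_simple_def)
    qed
    show "x \<otimes> n \<otimes> inv x \<in> \<psi> ` carrier S" if "x \<in> K" "n \<in> \<psi> ` carrier S" for x n
      using \<alpha> that by auto
  next
    fix M
    assume M: "subgroup M G \<and> M \<subseteq> \<psi> ` carrier S \<and>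
      (\<forall>x\<in>\<psi> ` carrier S. \<forall>m\<in>M. x \<otimes> m \<otimes> inv x \<in> M)"
    \<comment> \<open>The preimage of \<open>M\<close> is normal in \<open>S\<close>, so simplicity
      of \<open>S\<close> decides what \<open>M\<close> is.\<close>
    let ?M = "{s \<in> carrier S. \<psi> s \<in> M}"
    have "subgroup ?M S"
      using M by (intro S.subgroupI) (auto simp: subgroup.m_closed subgroup.m_inv_closed
        subgroup.one_closed intro!: exI[of _ "\<one>\<^bsub>S\<^esub>"])
    then have "?M \<lhd> S" using M by (auto simp: S.normal_inv_iff S.subgroup_self)
    then have "?M = carrier S \<or> ?M = {\<one>\<^bsub>S\<^esub>}"
      using S by (auto simp: nonabelian_simple_def)
    moreover have "M = \<psi> ` ?M" using M by auto
    ultimately show "M = \<psi> ` carrier S \<or> M = {\<one>}" by auto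
  next
    fix x assume x: "x \<in> K" and comm: "\<forall>n\<in>\<psi> ` carrier S. x \<otimes> n = n \<otimes> x"
    show "x = \<one>"
    proof (rule faithful[OF x])
      fix s assume s: "s \<in> carrier S"
      have "\<psi> (\<alpha> x s) = x \<otimes> \<psi> s \<otimes> inv x" using \<alpha> x s by auto
      also have "\<dots> = \<psi> s \<otimes> x \<otimes> inv x" using comm s by simp
      also have "\<dots> = \<psi> s" using s x KG by (simp add: m_assoc subset_iff)
      finally show "\<alpha> x s = s" using inj_onD[OF inj] \<alpha> x s by blast
    qed
  qed
qed

text \<open>The centre is a normal subgroup, and it is not the whole group because \<open>S\<close>
  is not commutative.\<close>

lemma nonabelian_simple_centre:
  assumes S: "nonabelian_simple S"
    and a: "a \<in> carrier S" "\<And>s. s \<in> carrier S \<Longrightarrow> a \<otimes>\<^bsub>S\<^esub> s = s \<otimes>\<^bsub>S\<^esub> a"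
  shows "a = \<one>\<^bsub>S\<^esub>"
proof -
  interpret S: group S using S by (simp add: nonabelian_simple_def)
  let ?Z = "{z \<in> carrier S. \<forall>s\<in>carrier S. z \<otimes>\<^bsub>S\<^esub> s = s \<otimes>\<^bsub>S\<^esub> z}"
  have "subgroup ?Z S"
  proof (rule S.subgroupI)
    fix z assume z: "z \<in> ?Z"
    have "inv\<^bsub>S\<^esub> z \<otimes>\<^bsub>S\<^esub> s = s \<otimes>\<^bsub>S\<^esub> inv\<^bsub>S\<^esub> z" if "s \<in> carrier S" for s
    proof -
      have "z \<otimes>\<^bsub>S\<^esub> inv\<^bsub>S\<^esub> s = inv\<^bsub>S\<^esub> s \<otimes>\<^bsub>S\<^esub> z" using z that by auto
      then have "inv\<^bsub>S\<^esub> (z \<otimes>\<^bsub>S\<^esub> inv\<^bsub>S\<^esub> s) = inv\<^bsub>S\<^esub> (inv\<^bsub>S\<^esub> s \<otimes>\<^bsub>S\<^esub> z)" by simp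
      moreover have "z \<in> carrier S" using z by simp
      ultimately show ?thesis using that by (simp add: S.inv_mult_group)
    qed
    then show "inv\<^bsub>S\<^esub> z \<in> ?Z" using z by auto
  next
    fix y z assume y: "y \<in> ?Z" and z: "z \<in> ?Z"
    then have c: "y \<in> carrier S" "z \<in> carrier S" by blast+
    have "y \<otimes>\<^bsub>S\<^esub> z \<otimes>\<^bsub>S\<^esub> s = s \<otimes>\<^bsub>S\<^esub> (y \<otimes>\<^bsub>S\<^esub> z)" if s: "s \<in> carrier S" for s
    proof -
      have "y \<otimes>\<^bsub>S\<^esub> z \<otimes>\<^bsub>S\<^esub> s = y \<otimes>\<^bsub>S\<^esub> (z \<otimes>\<^bsub>S\<^esub> s)" using c s by (rule S.m_assoc)
      also have "z \<otimes>\<^bsub>S\<^esub> s = s \<otimes>\<^bsub>S\<^esub> z" using z s by blast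
      also have "y \<otimes>\<^bsub>S\<^esub> (s \<otimes>\<^bsub>S\<^esub> z) = y \<otimes>\<^bsub>S\<^esub> s \<otimes>\<^bsub>S\<^esub> z"
        using c s by (simp only: S.m_assoc)
      also have "y \<otimes>\<^bsub>S\<^esub> s = s \<otimes>\<^bsub>S\<^esub> y" using y s by blast
      finally show ?thesis using c s by (simp only: S.m_assoc)
    qed
    then show "y \<otimes>\<^bsub>S\<^esub> z \<in> ?Z" using c by blast
  qed (auto intro!: exI[of _ "\<one>\<^bsub>S\<^esub>"])
  moreover have "x \<otimes>\<^bsub>S\<^esub> z \<otimes>\<^bsub>S\<^esub> inv\<^bsub>S\<^esub> x \<in> ?Z" if x: "x \<in> carrier S" and z: "z \<in> ?Z" for x z
  proof -
    have "x \<otimes>\<^bsub>S\<^esub> z = z \<otimes>\<^bsub>S\<^esub> x" using x z by simp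
    moreover have "z \<in> carrier S" using z by blast
    ultimately have "x \<otimes>\<^bsub>S\<^esub> z \<otimes>\<^bsub>S\<^esub> inv\<^bsub>S\<^esub> x = z" using x by (simp add: S.m_assoc)
    then show ?thesis using z by simp
  qed
  ultimately have "?Z \<lhd> S" unfolding S.normal_inv_iff by blast
  then have "?Z = carrier S \<or> ?Z = {\<one>\<^bsub>S\<^esub>}"
    using S by (simp add: nonabelian_simple_def)
  moreover have "?Z \<noteq> carrier S"
  proof
    assume "?Z = carrier S"
    then have "comm_group S" by (intro S.group_comm_groupI) blast
    then show False using S by (simp add: nonabelian_simple_def)
  qed
  ultimately show ?thesis using a by blast
qed

text \<open>The witness is the preimage of \<open>inner_auto S\<close> under an isomorphism from
  \<open>K\<close> to \<open>A\<close>.\<close>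

lemma almost_simple_socle_witness:
  fixes G :: "'a monoid" (structure)
  assumes "group G" and K: "subgroup K G" and as: "almost_simple (G\<lparr>carrier := K\<rparr>)"
  obtains N where "group.socle_witness G N K"
proof -
  interpret group G by fact
  interpret K: group "G\<lparr>carrier := K\<rparr>"
    by (rule subgroup_imp_group[OF K])
  obtain S :: "'a monoid" and A where S: "nonabelian_simple S"
    and A: "subgroup A (AutoGroup S)" and inn: "inner_auto S \<subseteq> A"
    and iso: "G\<lparr>carrier := K\<rparr> \<cong> AutoGroup S \<lparr>carrier := A\<rparr>"
    using as unfolding almost_simple_def by blast
  interpret S: group S using S by (simp add: nonabelian_simple_def)
  interpret AS: group "AutoGroup S" by (rule S.AutoGroup)
  interpret A: group "AutoGroup S \<lparr>carrier := A\<rparr>"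
    by (rule AS.subgroup_imp_group[OF A])
  obtain \<phi> where \<phi>: "\<phi> \<in> iso (G\<lparr>carrier := K\<rparr>) (AutoGroup S \<lparr>carrier := A\<rparr>)"
    using iso by (auto simp: is_iso_def)
  define \<psi>0 where "\<psi>0 = inv_into K \<phi>"
  define c where "c a = (\<lambda>s\<in>carrier S. a \<otimes>\<^bsub>S\<^esub> s \<otimes>\<^bsub>S\<^esub> inv\<^bsub>S\<^esub> a)" for a
  have AutoA: "A \<subseteq> auto S" using subgroup.subset[OF A] by (simp add: AutoGroup_def)
  have mA: "f \<otimes>\<^bsub>AutoGroup S\<^esub> g = compose (carrier S) f g" if "f \<in> A" "g \<in> A" for f g
    using that AutoA by (auto simp: AutoGroup_def BijGroup_def auto_def)
  have oneA: "\<one>\<^bsub>AutoGroup S\<^esub> = (\<lambda>s\<in>carrier S. s)"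
    by (simp add: AutoGroup_def BijGroup_def)
  have bij: "bij_betw \<phi> K A" using \<phi> by (simp add: iso_def)
  have hom: "\<phi> (x \<otimes> y) = compose (carrier S) (\<phi> x) (\<phi> y)" if "x \<in> K" "y \<in> K" for x y
    using \<phi> that bij_betw_apply[OF bij] by (simp add: iso_def hom_def mA)
  have cA: "c a \<in> A" if "a \<in> carrier S" for a
    using inn that by (auto simp: inner_auto_def c_def)
  have \<psi>0K: "\<psi>0 f \<in> K" "\<phi> (\<psi>0 f) = f" if "f \<in> A" for f
    using bij that by (auto simp: \<psi>0_def bij_betw_def inv_into_into f_inv_into_f)
  have inj: "x = y" if "x \<in> K" "y \<in> K" "\<phi> x = \<phi> y" for x y
    using bij that by (auto simp: bij_betw_def inj_on_def)
  have KG: "K \<subseteq> carrier G" using K subgroup.subset by blast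
  have mK: "x \<otimes> y \<in> K" if "x \<in> K" "y \<in> K" for x y
    using that K subgroup.m_closed by fast
  let ?\<psi> = "\<lambda>a. \<psi>0 (c a)"
  have cc: "compose (carrier S) (c a) (c b) = c (a \<otimes>\<^bsub>S\<^esub> b)"
    if "a \<in> carrier S" "b \<in> carrier S" for a b
    using that by (auto simp: compose_def c_def S.inv_mult_group S.m_assoc)
  have "socle_witness (?\<psi> ` carrier S) K"
  \<comment> \<open>Each \<open>\<phi> k\<close> is an automorphism of \<open>S\<close>, and
    conjugating the inner automorphism \<open>c s\<close> by it gives \<open>c (\<phi> k s)\<close>.
    So \<open>\<phi>\<close> itself describes the conjugation action of \<open>K\<close> on the copy
    of \<open>S\<close>.\<close>
  proof (rule socle_witness_image[OF K S, where \<alpha> = \<phi>])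
    show "?\<psi> \<in> hom S G"
    proof (rule homI)
      show "?\<psi> a \<in> carrier G" if "a \<in> carrier S" for a
        using \<psi>0K cA that KG by blast
      fix a b assume ab: "a \<in> carrier S" "b \<in> carrier S"
      show "?\<psi> (a \<otimes>\<^bsub>S\<^esub> b) = ?\<psi> a \<otimes> ?\<psi> b"
        using ab by (intro inj) (simp_all add: \<psi>0K cA hom cc mK)
    qed
    show "?\<psi> ` carrier S \<subseteq> K" using \<psi>0K cA by blast
    show "inj_on ?\<psi> (carrier S)"
    proof
      fix a b assume ab: "a \<in> carrier S" "b \<in> carrier S" and "?\<psi> a = ?\<psi> b"
      then have cab: "c a = c b" using \<psi>0K cA by metis
      \<comment> \<open>If \<open>a\<close> and \<open>b\<close> induce the same inner automorphism,
        this quotient is central.\<close>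
      let ?z = "inv\<^bsub>S\<^esub> b \<otimes>\<^bsub>S\<^esub> a"
      have "?z = \<one>\<^bsub>S\<^esub>"
      proof (rule nonabelian_simple_centre[OF S])
        fix s assume s: "s \<in> carrier S"
        have "a \<otimes>\<^bsub>S\<^esub> s \<otimes>\<^bsub>S\<^esub> inv\<^bsub>S\<^esub> a = b \<otimes>\<^bsub>S\<^esub> s \<otimes>\<^bsub>S\<^esub> inv\<^bsub>S\<^esub> b"
          using fun_cong[OF cab, of s] s by (simp add: c_def)
        then have "inv\<^bsub>S\<^esub> b \<otimes>\<^bsub>S\<^esub> (a \<otimes>\<^bsub>S\<^esub> s \<otimes>\<^bsub>S\<^esub> inv\<^bsub>S\<^esub> a) \<otimes>\<^bsub>S\<^esub> a
          = inv\<^bsub>S\<^esub> b \<otimes>\<^bsub>S\<^esub> (b \<otimes>\<^bsub>S\<^esub> s \<otimes>\<^bsub>S\<^esub> inv\<^bsub>S\<^esub> b) \<otimes>\<^bsub>S\<^esub> a" by simp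
        also have "\<dots> = s \<otimes>\<^bsub>S\<^esub> ?z"
          using ab s by (simp add: S.m_assoc[symmetric])
        also have "inv\<^bsub>S\<^esub> b \<otimes>\<^bsub>S\<^esub> (a \<otimes>\<^bsub>S\<^esub> s \<otimes>\<^bsub>S\<^esub> inv\<^bsub>S\<^esub> a) \<otimes>\<^bsub>S\<^esub> a = ?z \<otimes>\<^bsub>S\<^esub> s"
          using ab s by (simp add: S.m_assoc)
        finally show "?z \<otimes>\<^bsub>S\<^esub> s = s \<otimes>\<^bsub>S\<^esub> ?z" .
      qed (use ab in simp)
      then show "a = b" using ab by (metis S.inv_closed S.inv_equality S.inv_inv)
    qed
    fix k s assume k: "k \<in> K" and s: "s \<in> carrier S"
    have auto: "\<phi> k \<in> auto S" using k bij_betw_apply[OF bij] AutoA by blast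
    then have kS: "\<phi> k t \<in> carrier S" if "t \<in> carrier S" for t
      using that by (auto simp: auto_def hom_def)
    \<comment> \<open>The conjugation identity in a form without inverses: after applying the
      injective \<open>\<phi>\<close>, both sides are compositions of automorphisms of
      \<open>S\<close>.\<close>
    have "k \<otimes> ?\<psi> s = ?\<psi> (\<phi> k s) \<otimes> k"
    proof (rule inj)
      interpret k: group_hom S S "\<phi> k"
        using auto by unfold_locales (simp add: auto_def)
      have "compose (carrier S) (\<phi> k) (c s) = compose (carrier S) (c (\<phi> k s)) (\<phi> k)"
        using s by (auto simp: kS compose_def c_def)
      then show "\<phi> (k \<otimes> ?\<psi> s) = \<phi> (?\<psi> (\<phi> k s) \<otimes> k)"
        using k s by (simp add: hom \<psi>0K cA kS)
    qed (use k s in \<open>simp_all add: \<psi>0K cA mK kS\<close>)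
    then show "\<phi> k s \<in> carrier S \<and> k \<otimes> ?\<psi> s \<otimes> inv k = ?\<psi> (\<phi> k s)"
      using s k kS KG \<psi>0K(1)[OF cA[OF kS[OF s]]] by (simp add: m_assoc subset_iff)
  next
    fix k assume k: "k \<in> K" and triv: "\<And>s. s \<in> carrier S \<Longrightarrow> \<phi> k s = s"
    \<comment> \<open>Elements of \<open>A\<close> are determined by their values on the carrier, so
      \<open>\<phi> k\<close> equals the unit of the automorphism group as a function.\<close>
    have "\<phi> k \<in> extensional (carrier S)"
      using k bij_betw_apply[OF bij] AutoA by (auto simp: auto_def Bij_def)
    then have "\<phi> k = (\<lambda>s\<in>carrier S. s)"
      using triv by (auto simp: fun_eq_iff extensional_def)
    moreover have "group_hom (G\<lparr>carrier := K\<rparr>) (AutoGroup S\<lparr>carrier := A\<rparr>) \<phi>"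
      using \<phi> by unfold_locales (simp add: iso_def)
    then have "\<phi> \<one> = (\<lambda>s\<in>carrier S. s)"
      using group_hom.hom_one oneA by fastforce
    ultimately show "k = \<one>"
      using inj k subgroup.one_closed[OF K] by simp
  qed
  then show ?thesis by (rule that)
qed

declare One_nat_def [simp del]

subsection \<open>Permutation groups and their orbital digraphs\<close>

lemma carrier_BijGroup [simp]: "carrier (BijGroup X) = Bij X"
  by (simp add: BijGroup_def)

lemma one_BijGroup: "\<one>\<^bsub>BijGroup X\<^esub> = (\<lambda>x\<in>X. x)"
  by (simp add: BijGroup_def)

lemma mult_BijGroup:
  "f \<in> Bij X \<Longrightarrow> g \<in> Bij X \<Longrightarrow> f \<otimes>\<^bsub>BijGroup X\<^esub> g = compose X f g"
  by (simp add: BijGroup_def)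

lemma Bij_apply: "f \<in> Bij X \<Longrightarrow> x \<in> X \<Longrightarrow> f x \<in> X"
  using Bij_imp_funcset by blast

lemma Bij_inj: "f \<in> Bij X \<Longrightarrow> x \<in> X \<Longrightarrow> y \<in> X \<Longrightarrow> f x = f y \<longleftrightarrow> x = y"
  by (auto simp: Bij_def bij_betw_def inj_on_eq_iff)

lemma Bij_surjE:
  assumes "f \<in> Bij X" "y \<in> X"
  obtains x where "x \<in> X" "f x = y"
proof -
  have "y \<in> f ` X" using assms by (simp add: Bij_def bij_betw_def)
  then show ?thesis using that by blast
qed

lemma Bij_ext: "f \<in> Bij X \<Longrightarrow> g \<in> Bij X \<Longrightarrow> (\<And>x. x \<in> X \<Longrightarrow> f x = g x) \<Longrightarrow> f = g"
  by (meson Bij_imp_extensional extensionalityI)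

lemma inv_BijGroup_apply:
  "f \<in> Bij X \<Longrightarrow> x \<in> X \<Longrightarrow> (inv\<^bsub>BijGroup X\<^esub> f) (f x) = x"
  using Bij_apply[of f X x] by (auto simp: inv_BijGroup Bij_def bij_betw_def)

lemma apply_inv_BijGroup:
  "f \<in> Bij X \<Longrightarrow> x \<in> X \<Longrightarrow> f ((inv\<^bsub>BijGroup X\<^esub> f) x) = x"
  by (auto simp: inv_BijGroup Bij_def bij_betw_def f_inv_into_f)

lemma inv_BijGroup_closed: "f \<in> Bij X \<Longrightarrow> inv\<^bsub>BijGroup X\<^esub> f \<in> Bij X"
  using group.inv_closed[OF group_BijGroup, of f X] by simp

text \<open>The orbit of a pair is the set of its images, so it suffices to compare these sets pair
  by pair.\<close>

lemma orbital_digraphs_eqI: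
  assumes "\<And>x y. x \<in> X \<Longrightarrow> y \<in> X \<Longrightarrow> (\<lambda>g. (g x, g y)) ` G = (\<lambda>g. (g x, g y)) ` H"
  shows "orbital_digraphs X G = orbital_digraphs X H"
proof -
  have "orbit (perm_group X G) (\<lambda>g. map_prod g g) p = orbit (perm_group X H) (\<lambda>g. map_prod g g) p"
    if "p \<in> X \<times> X" for p
    using assms[of "fst p" "snd p"] that
    by (auto simp: orbit_def map_prod_def image_def split: prod.splits) blast+
  then have "orbits (perm_group X G) (X \<times> X) (\<lambda>g. map_prod g g)
      = orbits (perm_group X H) (X \<times> X) (\<lambda>g. map_prod g g)"
    unfolding orbits_def by (metis (lifting))
  then show ?thesis by (simp add: orbital_digraphs_def)
qed

text \<open>The \<open>H\<close>-orbit of \<open>(x, y)\<close> is the \<open>G\<close>-orbit of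
  some pair \<open>(a, b)\<close>. It contains both \<open>(x, y)\<close> and
  \<open>(h x, h y)\<close>, so elements \<open>g1\<close> and \<open>g2\<close> of \<open>G\<close>
  carry \<open>(a, b)\<close> to these pairs; then \<open>g2\<close> after the inverse of
  \<open>g1\<close> is as required.\<close>

lemma orbital_digraphs_eqD:
  assumes eq: "orbital_digraphs X G = orbital_digraphs X H"
    and G: "subgroup G (BijGroup X)" and H: "subgroup H (BijGroup X)"
    and xy: "x \<in> X" "y \<in> X" and h: "h \<in> H"
  obtains g where "g \<in> G" "g x = h x" "g y = h y"
proof -
  let ?orb = "\<lambda>G p. orbit (perm_group X G) (\<lambda>g. map_prod g g) p"
  have GB: "G \<subseteq> Bij X" using subgroup.subset[OF G] by simp
  have "\<lparr>pverts = X, parcs = ?orb H (x, y)\<rparr> \<in> orbital_digraphs X G"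
    unfolding eq unfolding orbital_digraphs_def orbits_def using xy by blast
  then obtain a b where ab: "a \<in> X" "b \<in> X" and orb: "?orb H (x, y) = ?orb G (a, b)"
    by (auto simp: orbital_digraphs_def orbits_def)
  have mem: "(f x, f y) \<in> ?orb G (a, b)" if "f \<in> H" for f
    using that unfolding orb[symmetric] by (force simp: orbit_def)
  have "\<one>\<^bsub>BijGroup X\<^esub> \<in> H" using H by (rule subgroup.one_closed)
  from mem[OF this] obtain g1 where g1: "g1 \<in> G" "g1 a = x" "g1 b = y"
    using xy by (auto simp: orbit_def one_BijGroup)
  from mem[OF h] obtain g2 where g2: "g2 \<in> G" "g2 a = h x" "g2 b = h y"
    by (auto simp: orbit_def)
  let ?g = "g2 \<otimes>\<^bsub>BijGroup X\<^esub> inv\<^bsub>BijGroup X\<^esub> g1"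
  have B: "g1 \<in> Bij X" "g2 \<in> Bij X" using g1 g2 GB by auto
  have "inv\<^bsub>BijGroup X\<^esub> g1 \<in> G" by (rule subgroup.m_inv_closed[OF G g1(1)])
  then have "?g \<in> G" using g2 by (intro subgroup.m_closed[OF G])
  moreover have "?g x = h x" "?g y = h y"
    using xy B g1(2,3) g2(2,3) ab inv_BijGroup_apply[OF B(1)]
    by (auto simp: mult_BijGroup inv_BijGroup_closed compose_def)
  ultimately show ?thesis by (rule that)
qed

subsection \<open>Elements of wreath products\<close>

text \<open>Evaluating at position \<open>h j\<close> removes the inverse of \<open>h\<close> from
  the definition. Later computations with entries use this form.\<close>

lemma product_action_apply:
  assumes "h \<in> Bij {1..r}" "x \<in> tuples r D" "j \<in> {1..r}"
  shows "product_action r D k h x (h j) = k j (x j)"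
proof -
  have "inv_into {1..r} h (h j) = j"
    using assms by (intro inv_into_f_f) (auto simp: Bij_def bij_betw_def)
  then show ?thesis using assms Bij_apply[OF assms(1,3)]
    by (simp add: product_action_def Let_def)
qed

lemma product_action_tuples:
  assumes "h \<in> Bij {1..r}" "k \<in> {1..r} \<rightarrow>\<^sub>E Bij D" "x \<in> tuples r D"
  shows "product_action r D k h x \<in> tuples r D"
proof -
  have "product_action r D k h x i \<in> D" if i: "i \<in> {1..r}" for i
  proof -
    obtain j where j: "j \<in> {1..r}" "h j = i" using Bij_surjE[OF assms(1) i] by blast
    have "k j \<in> Bij D" "x j \<in> D" using assms j by auto
    then show ?thesis
      using product_action_apply[OF assms(1,3) j(1), of k] j by (simp add: Bij_apply)
  qed
  moreover have "product_action r D k h x \<in> extensional {1..r}"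
    using assms by (simp add: product_action_def)
  ultimately show ?thesis by (auto simp: PiE_def)
qed

text \<open>The positions \<open>h j\<close> exhaust \<open>{1..r}\<close> because \<open>h\<close>
  is onto.\<close>

lemma product_action_eqI:
  assumes "h \<in> Bij {1..r}" "k \<in> {1..r} \<rightarrow>\<^sub>E Bij D" "x \<in> tuples r D" "y \<in> tuples r D"
    and "\<And>j. j \<in> {1..r} \<Longrightarrow> y (h j) = k j (x j)"
  shows "product_action r D k h x = y"
proof (rule PiE_ext[OF product_action_tuples[OF assms(1-3)] assms(4)])
  fix i assume "i \<in> {1..r}"
  then obtain j where j: "j \<in> {1..r}" "h j = i" using Bij_surjE[OF assms(1)] by blast
  then show "product_action r D k h x i = y i"
    using assms(5)[OF j(1)] product_action_apply[OF assms(1,3) j(1), of k] by simp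
qed

lemma product_action_Bij:
  assumes h: "h \<in> Bij {1..r}" and k: "k \<in> {1..r} \<rightarrow>\<^sub>E Bij D"
  shows "product_action r D k h \<in> Bij (tuples r D)"
proof -
  have kB: "k j \<in> Bij D" if "j \<in> {1..r}" for j using k that by blast
  have "inj_on (product_action r D k h) (tuples r D)"
  proof (rule inj_onI, rule PiE_ext)
    fix x y j assume xy: "x \<in> tuples r D" "y \<in> tuples r D" and j: "j \<in> {1..r}"
      and eq: "product_action r D k h x = product_action r D k h y"
    have "k j (x j) = k j (y j)"
      using product_action_apply[OF h _ j] xy eq by metis
    moreover have "x j \<in> D" "y j \<in> D" using xy j by auto
    ultimately show "x j = y j" using Bij_inj[OF kB[OF j]] by blast
  qed
  moreover have "y \<in> product_action r D k h ` tuples r D" if y: "y \<in> tuples r D" for y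
  proof
    \<comment> \<open>The preimage of \<open>y\<close>: fetch the entry at position
      \<open>h j\<close> and undo \<open>k j\<close>.\<close>
    let ?x = "\<lambda>j\<in>{1..r}. (inv\<^bsub>BijGroup D\<^esub> (k j)) (y (h j))"
    have yD: "y (h j) \<in> D" if "j \<in> {1..r}" for j
      using y Bij_apply[OF h that] by blast
    show x: "?x \<in> tuples r D"
      using yD Bij_apply[OF inv_BijGroup_closed[OF kB]] by auto
    show "y = product_action r D k h ?x"
      using yD apply_inv_BijGroup[OF kB]
      by (intro product_action_eqI[OF h k x y, symmetric]) simp
  qed
  moreover have "product_action r D k h ` tuples r D \<subseteq> tuples r D"
    using product_action_tuples[OF h k] by blast
  ultimately show ?thesis
    by (auto simp: Bij_def bij_betw_def product_action_def)
qed

text \<open>The right factor acts first: it applies \<open>k j\<close> to the entry at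
  \<open>j\<close> and moves it to position \<open>h j\<close>, where the left factor applies
  \<open>k' (h j)\<close>.\<close>

lemma product_action_mult:
  assumes h: "h \<in> Bij {1..r}" and k: "k \<in> {1..r} \<rightarrow>\<^sub>E Bij D"
    and h': "h' \<in> Bij {1..r}" and k': "k' \<in> {1..r} \<rightarrow>\<^sub>E Bij D"
  shows "product_action r D k' h' \<otimes>\<^bsub>BijGroup (tuples r D)\<^esub> product_action r D k h =
    product_action r D (\<lambda>j\<in>{1..r}. k' (h j) \<otimes>\<^bsub>BijGroup D\<^esub> k j) (h' \<otimes>\<^bsub>BijGroup {1..r}\<^esub> h)"
proof -
  have kB: "k j \<in> Bij D" "k' (h j) \<in> Bij D" if "j \<in> {1..r}" for j
    using k k' that Bij_apply[OF h that] by blast+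
  have H: "h' \<otimes>\<^bsub>BijGroup {1..r}\<^esub> h \<in> Bij {1..r}"
    using h h' by (simp add: mult_BijGroup compose_Bij)
  have K: "(\<lambda>j\<in>{1..r}. k' (h j) \<otimes>\<^bsub>BijGroup D\<^esub> k j) \<in> {1..r} \<rightarrow>\<^sub>E Bij D"
    using kB by (simp add: mult_BijGroup compose_Bij)
  show ?thesis
  proof (rule Bij_ext)
    show "product_action r D k' h' \<otimes>\<^bsub>BijGroup (tuples r D)\<^esub> product_action r D k h \<in> Bij (tuples r D)"
      by (simp add: assms mult_BijGroup compose_Bij product_action_Bij)
    show "product_action r D (\<lambda>j\<in>{1..r}. k' (h j) \<otimes>\<^bsub>BijGroup D\<^esub> k j) (h' \<otimes>\<^bsub>BijGroup {1..r}\<^esub> h)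
      \<in> Bij (tuples r D)"
      by (rule product_action_Bij[OF H K])
    fix x assume x: "x \<in> tuples r D"
    let ?y = "product_action r D k h x"
    have y: "?y \<in> tuples r D" by (rule product_action_tuples[OF h k x])
    have "product_action r D (\<lambda>j\<in>{1..r}. k' (h j) \<otimes>\<^bsub>BijGroup D\<^esub> k j) (h' \<otimes>\<^bsub>BijGroup {1..r}\<^esub> h) x
      = product_action r D k' h' ?y"
    proof (rule product_action_eqI[OF H K x product_action_tuples[OF h' k' y]])
      fix j assume j: "j \<in> {1..r}"
      have "x j \<in> D" using x j by blast
      then show "product_action r D k' h' ?y ((h' \<otimes>\<^bsub>BijGroup {1..r}\<^esub> h) j) =
          (\<lambda>j\<in>{1..r}. k' (h j) \<otimes>\<^bsub>BijGroup D\<^esub> k j) j (x j)"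
        using j product_action_apply[OF h' y Bij_apply[OF h j], of k']
          product_action_apply[OF h x j, of k]
        by (simp add: mult_BijGroup[OF h' h] mult_BijGroup kB compose_def)
    qed
    then show "(product_action r D k' h' \<otimes>\<^bsub>BijGroup (tuples r D)\<^esub> product_action r D k h) x =
      product_action r D (\<lambda>j\<in>{1..r}. k' (h j) \<otimes>\<^bsub>BijGroup D\<^esub> k j) (h' \<otimes>\<^bsub>BijGroup {1..r}\<^esub> h) x"
      using x by (simp add: mult_BijGroup product_action_Bij assms compose_def)
  qed
qed

lemma product_action_one:
  "product_action r D (\<lambda>j\<in>{1..r}. \<one>\<^bsub>BijGroup D\<^esub>) (\<lambda>i\<in>{1..r}. i) = \<one>\<^bsub>BijGroup (tuples r D)\<^esub>"
proof (rule Bij_ext)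
  show "product_action r D (\<lambda>j\<in>{1..r}. \<one>\<^bsub>BijGroup D\<^esub>) (\<lambda>i\<in>{1..r}. i) \<in> Bij (tuples r D)"
    by (intro product_action_Bij) (auto simp: one_BijGroup id_Bij)
  show "\<one>\<^bsub>BijGroup (tuples r D)\<^esub> \<in> Bij (tuples r D)"
    by (simp add: one_BijGroup id_Bij)
  fix x assume x: "x \<in> tuples r D"
  have "product_action r D (\<lambda>j\<in>{1..r}. \<one>\<^bsub>BijGroup D\<^esub>) (\<lambda>i\<in>{1..r}. i) x = x"
    using x by (intro product_action_eqI) (auto simp: one_BijGroup id_Bij)
  then show "product_action r D (\<lambda>j\<in>{1..r}. \<one>\<^bsub>BijGroup D\<^esub>) (\<lambda>i\<in>{1..r}. i) x =
      \<one>\<^bsub>BijGroup (tuples r D)\<^esub> x"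
    using x by (simp add: one_BijGroup)
qed

lemma product_action_inv:
  assumes h: "h \<in> Bij {1..r}" and k: "k \<in> {1..r} \<rightarrow>\<^sub>E Bij D"
  shows "inv\<^bsub>BijGroup (tuples r D)\<^esub> (product_action r D k h) =
    product_action r D (\<lambda>i\<in>{1..r}. inv\<^bsub>BijGroup D\<^esub> (k ((inv\<^bsub>BijGroup {1..r}\<^esub> h) i)))
      (inv\<^bsub>BijGroup {1..r}\<^esub> h)"
proof -
  let ?h' = "inv\<^bsub>BijGroup {1..r}\<^esub> h"
  let ?k' = "\<lambda>i\<in>{1..r}. inv\<^bsub>BijGroup D\<^esub> (k (?h' i))"
  have h': "?h' \<in> Bij {1..r}" using h by (rule inv_BijGroup_closed)
  have k': "?k' \<in> {1..r} \<rightarrow>\<^sub>E Bij D"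
    using k Bij_apply[OF h'] by (auto intro!: inv_BijGroup_closed)
  interpret D: group "BijGroup D" by (rule group_BijGroup)
  interpret I: group "BijGroup {1..r}" by (rule group_BijGroup)
  have kB: "k j \<in> Bij D" if "j \<in> {1..r}" for j using k that by blast
  have "(\<lambda>j\<in>{1..r}. ?k' (h j) \<otimes>\<^bsub>BijGroup D\<^esub> k j) = (\<lambda>j\<in>{1..r}. \<one>\<^bsub>BijGroup D\<^esub>)"
    using D.l_inv Bij_apply[OF h] kB inv_BijGroup_apply[OF h] by (intro restrict_ext) simp
  moreover have "?h' \<otimes>\<^bsub>BijGroup {1..r}\<^esub> h = (\<lambda>i\<in>{1..r}. i)"
    using h by (simp add: I.l_inv) (simp add: one_BijGroup)
  ultimately have "product_action r D ?k' ?h' \<otimes>\<^bsub>BijGroup (tuples r D)\<^esub> product_action r D k h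
      = \<one>\<^bsub>BijGroup (tuples r D)\<^esub>"
    by (simp only: product_action_mult[OF h k h' k'] product_action_one)
  then show ?thesis
    by (rule group.inv_equality[OF group_BijGroup])
      (use product_action_Bij[OF h k] product_action_Bij[OF h' k'] in simp_all)
qed

text \<open>Two points of \<open>D\<close> suffice to detect which position of the image depends on
  a given position of the argument, and this determines \<open>h\<close>. Constant tuples then
  determine \<open>k\<close>.\<close>

lemma product_action_inject:
  assumes D: "a \<in> D" "b \<in> D" "a \<noteq> b"
    and h: "h \<in> Bij {1..r}" and k: "k \<in> {1..r} \<rightarrow>\<^sub>E Bij D"
    and h': "h' \<in> Bij {1..r}" and k': "k' \<in> {1..r} \<rightarrow>\<^sub>E Bij D"
    and eq: "product_action r D k h = product_action r D k' h'"
  shows "k = k'" and "h = h'"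
proof -
  have hj: "h j = h' j" if j: "j \<in> {1..r}" for j
  proof (rule ccontr)
    assume ne: "h j \<noteq> h' j"
    \<comment> \<open>\<open>j'\<close> is the position from which the second description takes the
      entry at \<open>h j\<close>; it differs from \<open>j\<close>.\<close>
    obtain j' where j': "j' \<in> {1..r}" "h' j' = h j"
      using Bij_surjE[OF h' Bij_apply[OF h j]] by blast
    \<comment> \<open>\<open>x\<close> and \<open>y\<close> differ only at \<open>j\<close>, hence
      agree at \<open>j'\<close>. The image entry at \<open>h j\<close> would then be the same for
      both, against injectivity of \<open>k j\<close>.\<close>
    define x where "x = (\<lambda>i\<in>{1..r}. a)"
    define y where "y = (\<lambda>i\<in>{1..r}. if i = j then b else a)"
    have xy: "x \<in> tuples r D" "y \<in> tuples r D" using D by (auto simp: x_def y_def)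
    have "k j (x j) = k' j' (x j')" "k j (y j) = k' j' (y j')"
      using product_action_apply[OF h _ j, of _ D k] product_action_apply[OF h' _ j'(1), of _ D k']
        xy eq j'(2) by metis+
    moreover have "x j' = y j'" using ne j' by (auto simp: x_def y_def)
    ultimately have "k j (x j) = k j (y j)" by simp
    moreover have "k j \<in> Bij D" using k j by blast
    ultimately show False using j D Bij_inj[of "k j" D a b] by (simp add: x_def y_def)
  qed
  then show "h = h'" by (rule Bij_ext[OF h h'])
  show "k = k'"
  proof (rule PiE_ext[OF k k'])
    fix j assume j: "j \<in> {1..r}"
    have "k j \<in> Bij D" "k' j \<in> Bij D" using k k' j by blast+
    then show "k j = k' j"
    proof (rule Bij_ext)
      fix d assume "d \<in> D"
      then have x: "(\<lambda>i\<in>{1..r}. d) \<in> tuples r D" by auto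
      have "k j ((\<lambda>i\<in>{1..r}. d) j) = k' j ((\<lambda>i\<in>{1..r}. d) j)"
        using product_action_apply[OF h x j, of k] product_action_apply[OF h' x j, of k']
          eq hj[OF j] by metis
      then show "k j d = k' j d" using j by simp
    qed
  qed
qed

lemma wreath_mono: "K \<subseteq> K' \<Longrightarrow> H \<subseteq> H' \<Longrightarrow> wreath r D K H \<subseteq> wreath r D K' H'"
  unfolding wreath_def using PiE_mono[of "{1..r}" "\<lambda>_. K" "\<lambda>_. K'"] by blast

lemma wreathE:
  assumes "g \<in> wreath r D K H"
  obtains k h where "k \<in> {1..r} \<rightarrow>\<^sub>E K" "h \<in> H" "g = product_action r D k h"
  using assms by (auto simp: wreath_def)

section \<open>Orbital digraphs of subsets of a wreath product\<close>

text \<open>The common core of both comparisons: \<open>X\<close> will be a relabelled copy of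
  \<open>G\<close>, or \<open>T wr P\<close>. In both cases \<open>X\<close> covers every
  \<open>h\<close> in \<open>P\<close> and is closed under left multiplication by the base group of
  \<open>T\<close>.\<close>

lemma orbital_digraphs_wreath:
  assumes L: "subgroup L (BijGroup D)" and T: "T \<subseteq> L" and P: "P \<subseteq> Bij {1..r}"
    and X: "X \<subseteq> wreath r D L P"
    and top: "\<And>h. h \<in> P \<Longrightarrow> \<exists>k \<in> {1..r} \<rightarrow>\<^sub>E L. product_action r D k h \<in> X"
    and closed: "\<And>t g. t \<in> base_power r D T \<Longrightarrow> g \<in> X \<Longrightarrow> t \<otimes>\<^bsub>BijGroup (tuples r D)\<^esub> g \<in> X"
    and TL: "\<And>l d e. l \<in> L \<Longrightarrow> d \<in> D \<Longrightarrow> e \<in> D \<Longrightarrow> \<exists>t\<in>T. t d = l d \<and> t e = l e"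
  shows "orbital_digraphs (tuples r D) X = orbital_digraphs (tuples r D) (wreath r D L P)"
proof (rule orbital_digraphs_eqI, rule equalityI)
  fix x y
  show "(\<lambda>g. (g x, g y)) ` X \<subseteq> (\<lambda>g. (g x, g y)) ` wreath r D L P"
    using X by blast
  assume x: "x \<in> tuples r D" and y: "y \<in> tuples r D"
  show "(\<lambda>g. (g x, g y)) ` wreath r D L P \<subseteq> (\<lambda>g. (g x, g y)) ` X"
  proof (rule image_subsetI)
    fix g assume "g \<in> wreath r D L P"
    then obtain k h where k: "k \<in> {1..r} \<rightarrow>\<^sub>E L" and h: "h \<in> P"
      and g: "g = product_action r D k h" by (rule wreathE)
    obtain k' where k': "k' \<in> {1..r} \<rightarrow>\<^sub>E L" and kX: "product_action r D k' h \<in> X"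
      using top[OF h] by blast
    have LB: "L \<subseteq> Bij D" using subgroup.subset[OF L] by simp
    have B: "h \<in> Bij {1..r}" "k \<in> {1..r} \<rightarrow>\<^sub>E Bij D" "k' \<in> {1..r} \<rightarrow>\<^sub>E Bij D"
      using h P k k' LB by blast+
    let ?z = "product_action r D k' h"
    have "\<exists>t\<in>T. t (?z x (h j)) = k j (x j) \<and> t (?z y (h j)) = k j (y j)" if j: "j \<in> {1..r}" for j
    proof -
      have kj: "k j \<in> L" "k' j \<in> L" "k' j \<in> Bij D" "k j \<in> Bij D" using k k' LB j by blast+
      \<comment> \<open>This element of \<open>L\<close> corrects \<open>k' j\<close> to
        \<open>k j\<close>. By \<open>TL\<close> some element of \<open>T\<close> has the same
        effect on the two entries coming from \<open>x\<close> and \<open>y\<close>,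
        simultaneously.\<close>
      let ?l = "k j \<otimes>\<^bsub>BijGroup D\<^esub> inv\<^bsub>BijGroup D\<^esub> (k' j)"
      have d: "x j \<in> D" "y j \<in> D" using x y j by blast+
      have l: "?l (k' j d) = k j d" if "d \<in> D" for d
        using kj that by (simp add: mult_BijGroup inv_BijGroup_closed compose_def
          inv_BijGroup_apply Bij_apply)
      have "?l \<in> L" using kj by (intro subgroup.m_closed[OF L] subgroup.m_inv_closed[OF L])
      from TL[OF this Bij_apply[OF kj(3) d(1)] Bij_apply[OF kj(3) d(2)]] show ?thesis
        using product_action_apply[OF B(1) x j] product_action_apply[OF B(1) y j] l d by simp
    qed
    then obtain s where s: "\<And>j. j \<in> {1..r} \<Longrightarrow> s j \<in> T"
      "\<And>j. j \<in> {1..r} \<Longrightarrow> s j (?z x (h j)) = k j (x j)"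
      "\<And>j. j \<in> {1..r} \<Longrightarrow> s j (?z y (h j)) = k j (y j)"
      by metis
    \<comment> \<open>The correction acts after the coordinates have been permuted, so the one
      chosen for \<open>j\<close> has to sit at position \<open>h j\<close>.\<close>
    define t where "t = (\<lambda>i\<in>{1..r}. s ((inv\<^bsub>BijGroup {1..r}\<^esub> h) i))"
    have t: "t \<in> {1..r} \<rightarrow>\<^sub>E T"
      using s(1) Bij_apply[OF inv_BijGroup_closed[OF B(1)]] by (auto simp: t_def)
    have th: "t (h j) = s j" if "j \<in> {1..r}" for j
      using that Bij_apply[OF B(1) that] B(1) by (simp add: t_def inv_BijGroup_apply)
    have tB: "t \<in> {1..r} \<rightarrow>\<^sub>E Bij D" using t T LB by blast
    let ?t = "product_action r D t (\<lambda>i\<in>{1..r}. i)"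
    have idB: "(\<lambda>i\<in>{1..r}. i) \<in> Bij {1..r}" by (rule id_Bij)
    have "?t \<in> base_power r D T" using t by (auto simp: base_power_def)
    then have X: "?t \<otimes>\<^bsub>BijGroup (tuples r D)\<^esub> ?z \<in> X" using closed kX by blast
    have g_eq: "(?t \<otimes>\<^bsub>BijGroup (tuples r D)\<^esub> ?z) w = g w"
      if w: "w \<in> tuples r D" and sw: "\<And>j. j \<in> {1..r} \<Longrightarrow> s j (?z w (h j)) = k j (w j)" for w
    proof -
      have z: "?z w \<in> tuples r D" by (rule product_action_tuples[OF B(1,3) w])
      have "g w = ?t (?z w)"
        unfolding g
      proof (rule product_action_eqI[OF B(1,2) w product_action_tuples[OF idB tB z]])
        fix j assume j: "j \<in> {1..r}"
        then show "?t (?z w) (h j) = k j (w j)"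
          using product_action_apply[OF idB z Bij_apply[OF B(1) j], of t] sw th Bij_apply[OF B(1) j]
          by simp
      qed
      then show ?thesis
        using w by (simp add: mult_BijGroup product_action_Bij idB tB B compose_def)
    qed
    show "(g x, g y) \<in> (\<lambda>g. (g x, g y)) ` X"
      using g_eq[OF x s(2)] g_eq[OF y s(3)] by (intro image_eqI[OF _ X]) simp
  qed
qed

subsection \<open>Component and top group\<close>

text \<open>The block of a tuple is its entry at \<open>1\<close>, which \<open>k 1\<close> carries
  to position \<open>h 1\<close>. The image is described by this position because it is a block of
  the original system only if the first coordinate is fixed.\<close>

lemma image_block:
  assumes h: "h \<in> Bij {1..r}" and k: "k \<in> {1..r} \<rightarrow>\<^sub>E Bij D" and r: "1 \<le> r" and d: "d \<in> D"
  shows "product_action r D k h ` block r D d = {y \<in> tuples r D. y (h 1) = k 1 d}"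
proof (intro equalityI subsetI)
  have 1: "1 \<in> {1..r}" using r by simp
  have k1: "k 1 \<in> Bij D" using k 1 by blast
  fix y
  show "y \<in> product_action r D k h ` block r D d \<Longrightarrow> y \<in> {y \<in> tuples r D. y (h 1) = k 1 d}"
    using product_action_tuples[OF h k] product_action_apply[OF h _ 1] by (auto simp: block_def)
  assume y: "y \<in> {y \<in> tuples r D. y (h 1) = k 1 d}"
  then obtain x where x: "x \<in> tuples r D" "product_action r D k h x = y"
    using Bij_surjE[OF product_action_Bij[OF h k]] by blast
  have "k 1 (x 1) = k 1 d" using product_action_apply[OF h x(1) 1, of k] x y by simp
  moreover have "x 1 \<in> D" using x 1 by blast
  ultimately have "x 1 = d" using Bij_inj[OF k1] d by blast
  then show "y \<in> product_action r D k h ` block r D d" using x by (auto simp: block_def)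
qed

text \<open>Gives the component in coordinates. An element that maps blocks to blocks must fix the
  coordinate \<open>1\<close>, and then it induces \<open>k 1\<close> on the blocks.\<close>

lemma component_eq:
  assumes G: "G \<subseteq> wreath r D (Bij D) (Bij {1..r})" and r: "1 \<le> r"
    and D: "a \<in> D" "b \<in> D" "a \<noteq> b"
  shows "component r D G = {k 1 | k h. k \<in> {1..r} \<rightarrow>\<^sub>E Bij D \<and> h \<in> Bij {1..r} \<and> h 1 = 1 \<and>
    product_action r D k h \<in> G}"
proof (intro equalityI subsetI)
  have 1: "1 \<in> {1..r}" using r by simp
  fix s assume "s \<in> component r D G"
  then obtain g where s: "s \<in> Bij D" and g: "g \<in> G"
    and gs: "\<And>d. d \<in> D \<Longrightarrow> g ` block r D d = block r D (s d)"
    by (auto simp: component_def block_stabilizer_def)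
  obtain k h where k: "k \<in> {1..r} \<rightarrow>\<^sub>E Bij D" and h: "h \<in> Bij {1..r}"
    and gkh: "g = product_action r D k h"
    using G g unfolding wreath_def by blast
  have k1: "k 1 \<in> Bij D" using k 1 by blast
  have eq: "y (h 1) = k 1 d \<longleftrightarrow> y 1 = s d" if "y \<in> tuples r D" "d \<in> D" for y d
    using gs[OF that(2)] image_block[OF h k r that(2)] that(1) unfolding gkh block_def by blast
  have h1: "h 1 = 1"
  proof (rule ccontr)
    assume ne: "h 1 \<noteq> 1"
    \<comment> \<open>All these tuples lie in one block, the image of the block of \<open>a\<close>,
      but the entry at \<open>h 1\<close> is the arbitrary point \<open>c\<close>. It would have to
      equal \<open>k 1 a\<close> for every \<open>c\<close>, which two distinct points
      exclude.\<close>
    define y where "y c = (\<lambda>i\<in>{1..r}. if i = 1 then s a else c)" for c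
    have "c = k 1 a" if c: "c \<in> D" for c
    proof -
      have "y c \<in> tuples r D" using c D Bij_apply[OF s] by (auto simp: y_def)
      from eq[OF this D(1)] show ?thesis
        using ne 1 Bij_apply[OF h 1] by (simp add: y_def)
    qed
    from this[OF D(1)] this[OF D(2)] D(3) show False by simp
  qed
  have "s = k 1"
  proof (rule Bij_ext[OF s k1])
    fix d assume d: "d \<in> D"
    have "(\<lambda>i\<in>{1..r}. s d) \<in> tuples r D" using Bij_apply[OF s d] by auto
    from eq[OF this d] show "s d = k 1 d" using h1 1 by simp
  qed
  then show "s \<in> {k 1 | k h. k \<in> {1..r} \<rightarrow>\<^sub>E Bij D \<and> h \<in> Bij {1..r} \<and> h 1 = 1 \<and>
      product_action r D k h \<in> G}"
    using k h h1 g gkh by blast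
next
  have 1: "1 \<in> {1..r}" using r by simp
  fix s assume "s \<in> {k 1 | k h. k \<in> {1..r} \<rightarrow>\<^sub>E Bij D \<and> h \<in> Bij {1..r} \<and> h 1 = 1 \<and>
      product_action r D k h \<in> G}"
  then obtain k h where k: "k \<in> {1..r} \<rightarrow>\<^sub>E Bij D" and h: "h \<in> Bij {1..r}" "h 1 = 1"
    and g: "product_action r D k h \<in> G" and s: "s = k 1" by blast
  have sB: "s \<in> Bij D" using k 1 s by blast
  have im: "product_action r D k h ` block r D d = block r D (s d)" if "d \<in> D" for d
    using image_block[OF h(1) k r that] h(2) s by (simp add: block_def)
  have "s ` D = D" using sB by (simp add: Bij_def bij_betw_def)
  moreover have "(\<lambda>B. product_action r D k h ` B) ` (block r D ` D) = block r D ` (s ` D)"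
    unfolding image_image by (intro image_cong refl im)
  ultimately have "(\<lambda>B. product_action r D k h ` B) ` (block r D ` D) = block r D ` D" by simp
  then show "s \<in> component r D G"
    unfolding component_def using im sB g
    by (intro CollectI conjI bexI[of _ "product_action r D k h"]) (simp_all add: block_stabilizer_def)
qed

lemma top_imageI:
  "h \<in> Bij {1..r} \<Longrightarrow> k \<in> {1..r} \<rightarrow>\<^sub>E Bij D \<Longrightarrow> product_action r D k h \<in> G \<Longrightarrow> h \<in> top_image r D G"
  by (auto simp: top_image_def)

lemma product_action_mult_closed:
  assumes G: "subgroup G (BijGroup (tuples r D))"
    and "h \<in> Bij {1..r}" "k \<in> {1..r} \<rightarrow>\<^sub>E Bij D" "product_action r D k h \<in> G"
    and "h' \<in> Bij {1..r}" "k' \<in> {1..r} \<rightarrow>\<^sub>E Bij D" "product_action r D k' h' \<in> G"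
  shows "(\<lambda>j\<in>{1..r}. k' (h j) \<otimes>\<^bsub>BijGroup D\<^esub> k j) \<in> {1..r} \<rightarrow>\<^sub>E Bij D"
    and "h' \<otimes>\<^bsub>BijGroup {1..r}\<^esub> h \<in> Bij {1..r}"
    and "product_action r D (\<lambda>j\<in>{1..r}. k' (h j) \<otimes>\<^bsub>BijGroup D\<^esub> k j) (h' \<otimes>\<^bsub>BijGroup {1..r}\<^esub> h) \<in> G"
proof -
  have "k j \<in> Bij D" "k' (h j) \<in> Bij D" if "j \<in> {1..r}" for j
    using assms(3,6) that Bij_apply[OF assms(2) that] by blast+
  then show "(\<lambda>j\<in>{1..r}. k' (h j) \<otimes>\<^bsub>BijGroup D\<^esub> k j) \<in> {1..r} \<rightarrow>\<^sub>E Bij D"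
    by (simp add: mult_BijGroup compose_Bij)
  show "h' \<otimes>\<^bsub>BijGroup {1..r}\<^esub> h \<in> Bij {1..r}"
    using assms by (simp add: mult_BijGroup compose_Bij)
  show "product_action r D (\<lambda>j\<in>{1..r}. k' (h j) \<otimes>\<^bsub>BijGroup D\<^esub> k j) (h' \<otimes>\<^bsub>BijGroup {1..r}\<^esub> h) \<in> G"
    using subgroup.m_closed[OF G assms(7,4)]
    unfolding product_action_mult[OF assms(2,3,5,6)] .
qed

lemma product_action_inv_closed:
  assumes G: "subgroup G (BijGroup (tuples r D))"
    and h: "h \<in> Bij {1..r}" and k: "k \<in> {1..r} \<rightarrow>\<^sub>E Bij D" and g: "product_action r D k h \<in> G"
  shows "(\<lambda>i\<in>{1..r}. inv\<^bsub>BijGroup D\<^esub> (k ((inv\<^bsub>BijGroup {1..r}\<^esub> h) i))) \<in> {1..r} \<rightarrow>\<^sub>E Bij D"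
    and "product_action r D (\<lambda>i\<in>{1..r}. inv\<^bsub>BijGroup D\<^esub> (k ((inv\<^bsub>BijGroup {1..r}\<^esub> h) i)))
      (inv\<^bsub>BijGroup {1..r}\<^esub> h) \<in> G"
proof -
  show "(\<lambda>i\<in>{1..r}. inv\<^bsub>BijGroup D\<^esub> (k ((inv\<^bsub>BijGroup {1..r}\<^esub> h) i))) \<in> {1..r} \<rightarrow>\<^sub>E Bij D"
    using k Bij_apply[OF inv_BijGroup_closed[OF h]] by (auto intro!: inv_BijGroup_closed)
  show "product_action r D (\<lambda>i\<in>{1..r}. inv\<^bsub>BijGroup D\<^esub> (k ((inv\<^bsub>BijGroup {1..r}\<^esub> h) i)))
      (inv\<^bsub>BijGroup {1..r}\<^esub> h) \<in> G"
    using subgroup.m_inv_closed[OF G g] unfolding product_action_inv[OF h k] .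
qed

lemma product_action_one_closed:
  assumes "subgroup G (BijGroup (tuples r D))"
  shows "product_action r D (\<lambda>j\<in>{1..r}. \<one>\<^bsub>BijGroup D\<^esub>) (\<lambda>i\<in>{1..r}. i) \<in> G"
  unfolding product_action_one using assms by (rule subgroup.one_closed)

lemma one_tuple_Bij: "(\<lambda>j\<in>{1..r}. \<one>\<^bsub>BijGroup D\<^esub>) \<in> {1..r} \<rightarrow>\<^sub>E Bij D"
  by (auto simp: one_BijGroup id_Bij)

text \<open>For elements fixing the coordinate \<open>1\<close>, the twist in the product and
  inverse formulas disappears at \<open>1\<close>, so \<open>k 1\<close> behaves
  multiplicatively.\<close>

lemma subgroup_component:
  assumes G: "subgroup G (BijGroup (tuples r D))" "G \<subseteq> wreath r D (Bij D) (Bij {1..r})"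
    and r: "1 \<le> r" and D: "a \<in> D" "b \<in> D" "a \<noteq> b"
  shows "subgroup (component r D G) (BijGroup D)"
proof -
  interpret B: group "BijGroup D" by (rule group_BijGroup)
  have 1: "1 \<in> {1..r}" using r by simp
  note eq = component_eq[OF G(2) r D]
  show ?thesis
  proof (rule B.subgroupI)
    show "component r D G \<subseteq> carrier (BijGroup D)" by (auto simp: component_def)
    have "(\<lambda>j\<in>{1..r}. \<one>\<^bsub>BijGroup D\<^esub>) 1 \<in> component r D G"
      unfolding eq using one_tuple_Bij product_action_one_closed[OF G(1)] id_Bij[of "{1..r}"] 1
      by (intro CollectI exI[of _ "\<lambda>j\<in>{1..r}. \<one>\<^bsub>BijGroup D\<^esub>"] exI[of _ "\<lambda>i\<in>{1..r}. i"]) simp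
    then show "component r D G \<noteq> {}" by blast
  next
    fix s assume "s \<in> component r D G"
    then obtain k h where k: "k \<in> {1..r} \<rightarrow>\<^sub>E Bij D" and h: "h \<in> Bij {1..r}" "h 1 = 1"
      and g: "product_action r D k h \<in> G" and s: "s = k 1" unfolding eq by blast
    have i1: "(inv\<^bsub>BijGroup {1..r}\<^esub> h) 1 = 1" using inv_BijGroup_apply[OF h(1) 1] h(2) by simp
    let ?k = "\<lambda>i\<in>{1..r}. inv\<^bsub>BijGroup D\<^esub> (k ((inv\<^bsub>BijGroup {1..r}\<^esub> h) i))"
    have "?k 1 \<in> component r D G"
      unfolding eq using product_action_inv_closed[OF G(1) h(1) k g] inv_BijGroup_closed[OF h(1)] i1
      by blast
    then show "inv\<^bsub>BijGroup D\<^esub> s \<in> component r D G" using i1 1 s by simp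
  next
    fix s' s assume "s' \<in> component r D G"
    then obtain k' h' where k': "k' \<in> {1..r} \<rightarrow>\<^sub>E Bij D" and h': "h' \<in> Bij {1..r}" "h' 1 = 1"
      and g': "product_action r D k' h' \<in> G" and s': "s' = k' 1" unfolding eq by blast
    assume "s \<in> component r D G"
    then obtain k h where k: "k \<in> {1..r} \<rightarrow>\<^sub>E Bij D" and h: "h \<in> Bij {1..r}" "h 1 = 1"
      and g: "product_action r D k h \<in> G" and s: "s = k 1" unfolding eq by blast
    have h1: "(h' \<otimes>\<^bsub>BijGroup {1..r}\<^esub> h) 1 = 1"
      using h h' 1 by (simp add: mult_BijGroup compose_def)
    have "(\<lambda>j\<in>{1..r}. k' (h j) \<otimes>\<^bsub>BijGroup D\<^esub> k j) 1 \<in> component r D G"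
      unfolding eq using product_action_mult_closed[OF G(1) h(1) k g h'(1) k' g'] h1 by blast
    then show "s' \<otimes>\<^bsub>BijGroup D\<^esub> s \<in> component r D G" using h 1 s s' by simp
  qed
qed

lemma subgroup_top_image:
  assumes G: "subgroup G (BijGroup (tuples r D))"
  shows "subgroup (top_image r D G) (BijGroup {1..r})"
proof -
  interpret B: group "BijGroup {1..r}" by (rule group_BijGroup)
  show ?thesis
  proof (rule B.subgroupI)
    show "top_image r D G \<subseteq> carrier (BijGroup {1..r})" by (auto simp: top_image_def)
    show "top_image r D G \<noteq> {}"
      using top_imageI[OF id_Bij one_tuple_Bij product_action_one_closed[OF G]] by blast
  next
    fix h assume "h \<in> top_image r D G"
    then obtain k where "h \<in> Bij {1..r}" "k \<in> {1..r} \<rightarrow>\<^sub>E Bij D" "product_action r D k h \<in> G"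
      by (auto simp: top_image_def)
    then show "inv\<^bsub>BijGroup {1..r}\<^esub> h \<in> top_image r D G"
      using product_action_inv_closed[OF G] by (intro top_imageI[OF inv_BijGroup_closed])
  next
    fix h' h assume "h' \<in> top_image r D G" "h \<in> top_image r D G"
    then obtain k k' where "h \<in> Bij {1..r}" "k \<in> {1..r} \<rightarrow>\<^sub>E Bij D" "product_action r D k h \<in> G"
      "h' \<in> Bij {1..r}" "k' \<in> {1..r} \<rightarrow>\<^sub>E Bij D" "product_action r D k' h' \<in> G"
      by (auto simp: top_image_def)
    note product_action_mult_closed[OF G this]
    then show "h' \<otimes>\<^bsub>BijGroup {1..r}\<^esub> h \<in> top_image r D G" by (intro top_imageI)
  qed
qed

text \<open>If the orbit \<open>O\<close> of the coordinate \<open>1\<close> were proper, the tuples which agree on \<open>O\<close> would form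
  the blocks of a nontrivial system of imprimitivity.\<close>

lemma top_image_transitive:
  assumes G: "subgroup G (BijGroup (tuples r D))" "G \<subseteq> wreath r D (Bij D) (Bij {1..r})"
    and prim: "primitive_on (tuples r D) G"
    and r: "1 \<le> r" and D: "a \<in> D" "b \<in> D" "a \<noteq> b" and i: "i \<in> {1..r}"
  obtains h where "h \<in> top_image r D G" "h 1 = i"
proof -
  note P = subgroup_top_image[OF G(1)]
  have PB: "top_image r D G \<subseteq> Bij {1..r}" by (auto simp: top_image_def)
  define Orb where "Orb = (\<lambda>h. h 1) ` top_image r D G"
  define cl where "cl x = {y \<in> tuples r D. \<forall>j\<in>Orb. y j = x j}" for x
  have 1: "1 \<in> {1..r}" using r by simp
  have Orb: "Orb \<subseteq> {1..r}" using PB Bij_apply[OF _ 1] by (auto simp: Orb_def)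
  have "(\<lambda>i\<in>{1..r}. i) \<in> top_image r D G"
    using subgroup.one_closed[OF P] by (simp add: one_BijGroup)
  then have 1: "1 \<in> Orb"
    unfolding Orb_def using 1 by (intro image_eqI[of _ _ "\<lambda>i\<in>{1..r}. i"]) simp_all
  have h_Orb: "h j \<in> Orb" if h: "h \<in> top_image r D G" and j: "j \<in> Orb" for h j
  proof -
    obtain h' where h': "h' \<in> top_image r D G" "j = h' 1" using j by (auto simp: Orb_def)
    have "h \<otimes>\<^bsub>BijGroup {1..r}\<^esub> h' \<in> top_image r D G"
      using subgroup.m_closed[OF P h h'(1)] .
    moreover have "(h \<otimes>\<^bsub>BijGroup {1..r}\<^esub> h') 1 = h j"
      using h h' PB r by (simp add: mult_BijGroup subset_iff compose_def)
    ultimately show ?thesis unfolding Orb_def by (metis imageI)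
  qed
  \<comment> \<open>Equality, which needs finiteness, makes agreement on \<open>Orb\<close> of two
    image tuples equivalent to agreement of the original ones.\<close>
  have Orb_image: "h ` Orb = Orb" if h: "h \<in> top_image r D G" for h
  proof (rule endo_inj_surj)
    show "finite Orb" using Orb finite_subset by blast
    show "h ` Orb \<subseteq> Orb" using h_Orb[OF h] by blast
    show "inj_on h Orb"
      using h PB Orb by (auto simp: Bij_def bij_betw_def intro: inj_on_subset)
  qed
  have part: "partition_on (tuples r D) (cl ` tuples r D)"
  proof (rule partition_onI)
    show "\<Union> (cl ` tuples r D) = tuples r D" by (auto simp: cl_def)
    show "disjnt p q" if "p \<in> cl ` tuples r D" "q \<in> cl ` tuples r D" "p \<noteq> q" for p q
      using that by (auto simp: cl_def disjnt_def)
    show "{} \<notin> cl ` tuples r D" by (auto simp: cl_def)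
  qed
  have inv: "g ` B \<in> cl ` tuples r D" if g: "g \<in> G" and B: "B \<in> cl ` tuples r D" for g B
  proof -
    obtain x where x: "x \<in> tuples r D" "B = cl x" using B by blast
    obtain k h where k: "k \<in> {1..r} \<rightarrow>\<^sub>E Bij D" and h: "h \<in> Bij {1..r}"
      and gkh: "g = product_action r D k h"
      using G(2) g unfolding wreath_def by blast
    have hP: "h \<in> top_image r D G" using h k g gkh by (auto intro: top_imageI)
    have gx: "g x \<in> tuples r D" using product_action_tuples[OF h k x(1)] gkh by simp
    have "g y \<in> cl (g x) \<longleftrightarrow> y \<in> cl x" if y: "y \<in> tuples r D" for y
    proof -
      have gy: "g y \<in> tuples r D" using product_action_tuples[OF h k y] gkh by simp
      have "g y (h j) = g x (h j) \<longleftrightarrow> y j = x j" if "j \<in> Orb" for j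
      proof -
        have j: "j \<in> {1..r}" using that Orb by blast
        have "k j \<in> Bij D" "y j \<in> D" "x j \<in> D" using k j x y by blast+
        then show ?thesis
          using product_action_apply[OF h y j, of k] product_action_apply[OF h x(1) j, of k] gkh
          by (simp add: Bij_inj)
      qed
      then have "(\<forall>j\<in>h ` Orb. g y j = g x j) \<longleftrightarrow> (\<forall>j\<in>Orb. y j = x j)" by simp
      then show ?thesis unfolding Orb_image[OF hP] using y gy by (simp add: cl_def)
    qed
    note cl_iff = this
    have "g ` cl x = cl (g x)"
    proof (intro equalityI subsetI)
      fix z assume "z \<in> g ` cl x"
      then obtain y where y: "y \<in> cl x" "z = g y" by blast
      then have "y \<in> tuples r D" by (simp add: cl_def)
      then show "z \<in> cl (g x)" using cl_iff y by simp
    next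
      fix z assume z: "z \<in> cl (g x)"
      then have "z \<in> tuples r D" by (simp add: cl_def)
      then obtain y where "y \<in> tuples r D" "z = g y"
        using Bij_surjE[OF product_action_Bij[OF h k]] gkh by metis
      then show "z \<in> g ` cl x" using cl_iff z by blast
    qed
    then show ?thesis using x gx by blast
  qed
  have cases: "cl ` tuples r D = {tuples r D} \<or> cl ` tuples r D = (\<lambda>x. {x}) ` tuples r D"
    using prim part inv by (simp add: primitive_on_def)
  \<comment> \<open>A constant tuple as test point. Changing its entry at \<open>1\<close>, which
    lies in \<open>Orb\<close>, leaves its class; so there is more than one class and primitivity
    forces all classes to be singletons.\<close>
  define x where "x = (\<lambda>j\<in>{1..r}. a)"
  have x: "x \<in> tuples r D" using D by (auto simp: x_def)
  have upd: "x(j := b) \<in> tuples r D" if "j \<in> {1..r}" for j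
    using that D by (auto simp: x_def PiE_def extensional_def)
  have "x(1 := b) \<notin> cl x" using 1 Orb D by (auto simp: cl_def x_def)
  then have "cl ` tuples r D \<noteq> {tuples r D}" using x upd[of 1] r by auto
  with cases have "cl x \<in> (\<lambda>x. {x}) ` tuples r D" using x by blast
  moreover have "x \<in> cl x" using x by (simp add: cl_def)
  ultimately have cl_x: "cl x = {x}" by auto
  \<comment> \<open>Changing an entry outside \<open>Orb\<close> would give a second element in the
    singleton class of \<open>x\<close>.\<close>
  have "i \<in> Orb"
  proof (rule ccontr)
    assume "i \<notin> Orb"
    then have "x(i := b) \<in> cl x" using upd[OF i] by (auto simp: cl_def)
    then have "x(i := b) = x" using cl_x by simp
    then have "b = x i" by (metis fun_upd_same)
    then show False using i D by (simp add: x_def)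
  qed
  then show ?thesis using that by (auto simp: Orb_def)
qed

text \<open>The decomposition of an element is unique, so membership can be read off from whichever
  decomposition is at hand.\<close>

lemma wreath_memD:
  assumes g: "product_action r D k h \<in> wreath r D K H" and K: "K \<subseteq> Bij D" and H: "H \<subseteq> Bij {1..r}"
    and D: "a \<in> D" "b \<in> D" "a \<noteq> b"
    and h: "h \<in> Bij {1..r}" and k: "k \<in> {1..r} \<rightarrow>\<^sub>E Bij D"
  shows "k \<in> {1..r} \<rightarrow>\<^sub>E K" and "h \<in> H"
proof -
  obtain k' h' where k': "k' \<in> {1..r} \<rightarrow>\<^sub>E K" and h': "h' \<in> H"
    and eq: "product_action r D k h = product_action r D k' h'"
    using g by (rule wreathE)
  have "k' \<in> {1..r} \<rightarrow>\<^sub>E Bij D" "h' \<in> Bij {1..r}" using k' h' K H by blast+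
  then have "k = k'" "h = h'" using product_action_inject[OF D h k _ _ eq] by blast+
  then show "k \<in> {1..r} \<rightarrow>\<^sub>E K" "h \<in> H" using k' h' by auto
qed

section \<open>Relabelling the coordinates\<close>

text \<open>The product of the inverse of the element for \<open>h2\<close>, the element for
  \<open>h\<close> and the element for \<open>h1\<close> moves the coordinate \<open>1\<close> to
  \<open>j\<close>, then to \<open>h j\<close>, then back to \<open>1\<close>. The displayed
  expression is its entry at \<open>1\<close>.\<close>

lemma component_transport:
  assumes G: "subgroup G (BijGroup (tuples r D))" "G \<subseteq> wreath r D (Bij D) (Bij {1..r})"
    and D: "a \<in> D" "b \<in> D" "a \<noteq> b" and j: "j \<in> {1..r}"
    and g: "h \<in> Bij {1..r}" "k \<in> {1..r} \<rightarrow>\<^sub>E Bij D" "product_action r D k h \<in> G"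
    and g1: "h1 \<in> Bij {1..r}" "k1 \<in> {1..r} \<rightarrow>\<^sub>E Bij D" "product_action r D k1 h1 \<in> G" "h1 1 = j"
    and g2: "h2 \<in> Bij {1..r}" "k2 \<in> {1..r} \<rightarrow>\<^sub>E Bij D" "product_action r D k2 h2 \<in> G" "h2 1 = h j"
  shows "inv\<^bsub>BijGroup D\<^esub> (k2 1) \<otimes>\<^bsub>BijGroup D\<^esub> (k j \<otimes>\<^bsub>BijGroup D\<^esub> k1 1) \<in> component r D G"
proof -
  have r: "1 \<le> r" and 1: "1 \<in> {1..r}" using j by auto
  let ?h2 = "inv\<^bsub>BijGroup {1..r}\<^esub> h2"
  let ?k2 = "\<lambda>i\<in>{1..r}. inv\<^bsub>BijGroup D\<^esub> (k2 (?h2 i))"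
  let ?h3 = "h \<otimes>\<^bsub>BijGroup {1..r}\<^esub> h1"
  let ?k3 = "\<lambda>i\<in>{1..r}. k (h1 i) \<otimes>\<^bsub>BijGroup D\<^esub> k1 i"
  let ?h = "?h2 \<otimes>\<^bsub>BijGroup {1..r}\<^esub> ?h3"
  let ?k = "\<lambda>i\<in>{1..r}. ?k2 (?h3 i) \<otimes>\<^bsub>BijGroup D\<^esub> ?k3 i"
  note m3 = product_action_mult_closed[OF G(1) g1(1-3) g]
  note m2 = product_action_inv_closed[OF G(1) g2(1-3)]
  note m = product_action_mult_closed[OF G(1) m3(2,1,3) inv_BijGroup_closed[OF g2(1)] m2]
  have h3: "?h3 1 = h j" using g1(4) 1 by (simp add: mult_BijGroup g g1 compose_def)
  have h2: "?h2 (h j) = 1" using inv_BijGroup_apply[OF g2(1) 1] g2(4) by simp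
  have "?h 1 = ?h2 (?h3 1)"
    using 1 by (simp add: mult_BijGroup[OF inv_BijGroup_closed[OF g2(1)] m3(2)] compose_def)
  then have "?h 1 = 1" using h2 h3 by simp
  then have "?k 1 \<in> component r D G"
    unfolding component_eq[OF G(2) r D] using m by blast
  moreover have "h j \<in> {1..r}" by (rule Bij_apply[OF g(1) j])
  ultimately show ?thesis using h2 h3 1 g1(4) by simp
qed

text \<open>Since \<open>u\<close> lies in the base group, the top part \<open>h\<close> is
  unchanged, while the base entries are conjugated with a twist by \<open>h\<close>.\<close>

lemma conjugate_product_action:
  assumes c: "c \<in> {1..r} \<rightarrow>\<^sub>E Bij D" and k: "k \<in> {1..r} \<rightarrow>\<^sub>E Bij D" and h: "h \<in> Bij {1..r}"
  defines "u \<equiv> product_action r D c (\<lambda>i\<in>{1..r}. i)"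
  defines "k' \<equiv> \<lambda>j\<in>{1..r}. c (h j) \<otimes>\<^bsub>BijGroup D\<^esub> k j \<otimes>\<^bsub>BijGroup D\<^esub> inv\<^bsub>BijGroup D\<^esub> (c j)"
  shows "u \<otimes>\<^bsub>BijGroup (tuples r D)\<^esub> product_action r D k h
      \<otimes>\<^bsub>BijGroup (tuples r D)\<^esub> inv\<^bsub>BijGroup (tuples r D)\<^esub> u = product_action r D k' h"
    and "k' \<in> {1..r} \<rightarrow>\<^sub>E Bij D"
proof -
  interpret T: group "BijGroup (tuples r D)" by (rule group_BijGroup)
  interpret D: group "BijGroup D" by (rule group_BijGroup)
  interpret I: group "BijGroup {1..r}" by (rule group_BijGroup)
  have id: "(\<lambda>i\<in>{1..r}. i) \<in> Bij {1..r}" by (rule id_Bij)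
  have hid: "h \<otimes>\<^bsub>BijGroup {1..r}\<^esub> (\<lambda>i\<in>{1..r}. i) = h" "(\<lambda>i\<in>{1..r}. i) \<otimes>\<^bsub>BijGroup {1..r}\<^esub> h = h"
    using I.r_one[of h] I.l_one[of h] h by (simp_all add: one_BijGroup)
  have B: "k j \<in> Bij D" "c j \<in> Bij D" "h j \<in> {1..r}" "c (h j) \<in> Bij D" if "j \<in> {1..r}" for j
    using k c that Bij_apply[OF h that] by blast+
  have closed: "x \<otimes>\<^bsub>BijGroup D\<^esub> y \<in> Bij D" if "x \<in> Bij D" "y \<in> Bij D" for x y
    using that D.m_closed by simp
  show k': "k' \<in> {1..r} \<rightarrow>\<^sub>E Bij D"
    using B by (auto simp: k'_def intro!: closed inv_BijGroup_closed)
  \<comment> \<open>It is enough to compare the products with \<open>u\<close> moved to the other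
    side, which avoids expanding its inverse.\<close>
  have "product_action r D k' h \<otimes>\<^bsub>BijGroup (tuples r D)\<^esub> u
      = product_action r D (\<lambda>j\<in>{1..r}. k' j \<otimes>\<^bsub>BijGroup D\<^esub> c j) h"
    unfolding u_def product_action_mult[OF id c h k'] hid
    by (rule arg_cong[where f = "\<lambda>k. product_action r D k h"]) auto
  also have "(\<lambda>j\<in>{1..r}. k' j \<otimes>\<^bsub>BijGroup D\<^esub> c j) = (\<lambda>j\<in>{1..r}. c (h j) \<otimes>\<^bsub>BijGroup D\<^esub> k j)"
    using B by (intro restrict_ext) (simp add: k'_def D.m_assoc closed inv_BijGroup_closed)
  also have "product_action r D \<dots> h = u \<otimes>\<^bsub>BijGroup (tuples r D)\<^esub> product_action r D k h"
    unfolding u_def product_action_mult[OF h k id c] hid using B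
    by (intro arg_cong[where f = "\<lambda>k. product_action r D k h"]) auto
  finally show "u \<otimes>\<^bsub>BijGroup (tuples r D)\<^esub> product_action r D k h
      \<otimes>\<^bsub>BijGroup (tuples r D)\<^esub> inv\<^bsub>BijGroup (tuples r D)\<^esub> u = product_action r D k' h"
    using T.inv_solve_right'[of "product_action r D k' h" "u \<otimes>\<^bsub>BijGroup (tuples r D)\<^esub> product_action r D k h" u]
      product_action_Bij[OF id c] product_action_Bij[OF h k] product_action_Bij[OF h k'] T.m_closed
    by (simp add: u_def T.m_assoc)
qed

text \<open>A base element whose entries normalize \<open>N\<close> normalizes the base group of
  \<open>N\<close>. In this form, a left factor \<open>t\<close> of a conjugate by \<open>u\<close>
  can be moved past \<open>u\<close> onto the conjugated element.\<close>

lemma base_power_mult_commute: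
  assumes N: "N \<subseteq> Bij D" and c: "c \<in> {1..r} \<rightarrow>\<^sub>E Bij D"
    and cN: "\<And>j n. j \<in> {1..r} \<Longrightarrow> n \<in> N \<Longrightarrow>
      inv\<^bsub>BijGroup D\<^esub> (c j) \<otimes>\<^bsub>BijGroup D\<^esub> n \<otimes>\<^bsub>BijGroup D\<^esub> c j \<in> N"
    and t: "t \<in> base_power r D N"
  defines "u \<equiv> product_action r D c (\<lambda>i\<in>{1..r}. i)"
  obtains t' where "t' \<in> base_power r D N"
    "t \<otimes>\<^bsub>BijGroup (tuples r D)\<^esub> u = u \<otimes>\<^bsub>BijGroup (tuples r D)\<^esub> t'"
proof -
  interpret D: group "BijGroup D" by (rule group_BijGroup)
  have id: "(\<lambda>i\<in>{1..r}. i) \<in> Bij {1..r}" by (rule id_Bij)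
  obtain n where n: "n \<in> {1..r} \<rightarrow>\<^sub>E N" and t: "t = product_action r D n (\<lambda>i\<in>{1..r}. i)"
    using t by (auto simp: base_power_def)
  let ?n = "\<lambda>j\<in>{1..r}. inv\<^bsub>BijGroup D\<^esub> (c j) \<otimes>\<^bsub>BijGroup D\<^esub> n j \<otimes>\<^bsub>BijGroup D\<^esub> c j"
  have "inv\<^bsub>BijGroup D\<^esub> (c j) \<otimes>\<^bsub>BijGroup D\<^esub> n j \<otimes>\<^bsub>BijGroup D\<^esub> c j \<in> N" if "j \<in> {1..r}" for j
    using cN[OF that] n that by blast
  then have n': "?n \<in> {1..r} \<rightarrow>\<^sub>E N" by simp
  have nB: "n \<in> {1..r} \<rightarrow>\<^sub>E Bij D" "?n \<in> {1..r} \<rightarrow>\<^sub>E Bij D" using n n' N by blast+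
  have B: "n j \<in> Bij D" "c j \<in> Bij D" if "j \<in> {1..r}" for j using nB c that by blast+
  have closed: "x \<otimes>\<^bsub>BijGroup D\<^esub> y \<in> Bij D" if "x \<in> Bij D" "y \<in> Bij D" for x y
    using that D.m_closed by simp
  have cn: "c j \<otimes>\<^bsub>BijGroup D\<^esub> (inv\<^bsub>BijGroup D\<^esub> (c j) \<otimes>\<^bsub>BijGroup D\<^esub> n j \<otimes>\<^bsub>BijGroup D\<^esub> c j)
      = n j \<otimes>\<^bsub>BijGroup D\<^esub> c j" if "j \<in> {1..r}" for j
    using B[OF that] by (simp add: D.m_assoc[symmetric] closed inv_BijGroup_closed)
  show ?thesis
  proof
    show "product_action r D ?n (\<lambda>i\<in>{1..r}. i) \<in> base_power r D N"
      using n' unfolding base_power_def by blast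
    show "t \<otimes>\<^bsub>BijGroup (tuples r D)\<^esub> u =
        u \<otimes>\<^bsub>BijGroup (tuples r D)\<^esub> product_action r D ?n (\<lambda>i\<in>{1..r}. i)"
      unfolding t u_def product_action_mult[OF id nB(2) id c] product_action_mult[OF id c id nB(1)]
      using cn
      by (intro arg_cong[where f = "\<lambda>k. product_action r D k _"] restrict_ext) simp
  qed
qed

text \<open>Together with \<open>conjugate_one\<close> this makes the statement about
  \<open>G\<close> itself an instance of the one about relabelled copies.\<close>

lemma one_relabelling: "\<one>\<^bsub>BijGroup (tuples r D)\<^esub> \<in> relabellings r D" if "1 \<le> r"
proof -
  have "(\<lambda>j\<in>{1..r}. \<one>\<^bsub>BijGroup D\<^esub>) 1 = (\<lambda>d\<in>D. d)" using that by (simp add: one_BijGroup)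
  then show ?thesis
    using one_tuple_Bij unfolding relabellings_def product_action_one[symmetric] by blast
qed

lemma conjugate_one:
  assumes "G \<subseteq> Bij X"
  shows "conjugate X \<one>\<^bsub>BijGroup X\<^esub> G = G"
proof -
  interpret group "BijGroup X" by (rule group_BijGroup)
  have "\<one>\<^bsub>BijGroup X\<^esub> \<otimes>\<^bsub>BijGroup X\<^esub> g \<otimes>\<^bsub>BijGroup X\<^esub> inv\<^bsub>BijGroup X\<^esub> \<one>\<^bsub>BijGroup X\<^esub> = g"
    if "g \<in> G" for g
    using assms that by auto
  then show ?thesis by (simp add: conjugate_def)
qed

text \<open>For each \<open>i\<close> choose an element of \<open>G\<close> moving the coordinate
  \<open>1\<close> to \<open>i\<close>, and use its entry at \<open>1\<close> to identify the
  \<open>i\<close>-th copy of \<open>D\<close> with the first. After this relabelling, every entry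
  of an element of \<open>G\<close> has the form treated in
  \<open>component_transport\<close>.\<close>

lemma conjugate_subset_wreath:
  assumes G: "subgroup G (BijGroup (tuples r D))" "G \<subseteq> wreath r D (Bij D) (Bij {1..r})"
    and prim: "primitive_on (tuples r D) G"
    and r: "1 \<le> r" and D: "a \<in> D" "b \<in> D" "a \<noteq> b"
  obtains u where "u \<in> relabellings r D"
    "conjugate (tuples r D) u G \<subseteq> wreath r D (component r D G) (top_image r D G)"
proof -
  interpret D: group "BijGroup D" by (rule group_BijGroup)
  have 1: "1 \<in> {1..r}" using r by simp
  \<comment> \<open>For \<open>i = 1\<close> the identity is chosen, because a relabelling must
    leave the first coordinate alone.\<close>
  have "\<exists>k h. h \<in> Bij {1..r} \<and> k \<in> {1..r} \<rightarrow>\<^sub>E Bij D \<and> product_action r D k h \<in> G \<and> h 1 = i \<and>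
      (i = 1 \<longrightarrow> k 1 = \<one>\<^bsub>BijGroup D\<^esub>)" if i: "i \<in> {1..r}" for i
  proof (cases "i = 1")
    case True
    show ?thesis
      using 1 True
      by (intro exI[of _ "\<lambda>j\<in>{1..r}. \<one>\<^bsub>BijGroup D\<^esub>"] exI[of _ "\<lambda>i\<in>{1..r}. i"] conjI
        id_Bij one_tuple_Bij product_action_one_closed[OF G(1)]) simp_all
  next
    case False
    obtain h where "h \<in> top_image r D G" "h 1 = i"
      using top_image_transitive[OF G prim r D i] .
    then show ?thesis using False by (auto simp: top_image_def)
  qed
  then obtain kk hh where h: "\<And>i. i \<in> {1..r} \<Longrightarrow> hh i \<in> Bij {1..r}"
    and k: "\<And>i. i \<in> {1..r} \<Longrightarrow> kk i \<in> {1..r} \<rightarrow>\<^sub>E Bij D"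
    and g: "\<And>i. i \<in> {1..r} \<Longrightarrow> product_action r D (kk i) (hh i) \<in> G"
    and h1: "\<And>i. i \<in> {1..r} \<Longrightarrow> hh i 1 = i"
    and k1: "kk 1 1 = \<one>\<^bsub>BijGroup D\<^esub>"
    using 1 by metis
  have kB: "kk i 1 \<in> Bij D" if "i \<in> {1..r}" for i using k[OF that] 1 by blast
  \<comment> \<open>The inverse occurs because \<open>kk i 1\<close> maps the first copy of
    \<open>D\<close> to the \<open>i\<close>-th, whereas the relabelling goes back.\<close>
  define c where "c = (\<lambda>i\<in>{1..r}. inv\<^bsub>BijGroup D\<^esub> (kk i 1))"
  have c: "c \<in> {1..r} \<rightarrow>\<^sub>E Bij D" using kB by (auto simp: c_def inv_BijGroup_closed)
  have "c 1 = (\<lambda>d\<in>D. d)" using k1 1 by (simp add: c_def) (simp add: one_BijGroup)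
  then have u: "product_action r D c (\<lambda>i\<in>{1..r}. i) \<in> relabellings r D" (is "?u \<in> _")
    using c unfolding relabellings_def by blast
  have "?u \<otimes>\<^bsub>BijGroup (tuples r D)\<^esub> x \<otimes>\<^bsub>BijGroup (tuples r D)\<^esub> inv\<^bsub>BijGroup (tuples r D)\<^esub> ?u
      \<in> wreath r D (component r D G) (top_image r D G)" if x: "x \<in> G" for x
  proof -
    obtain k' h' where k': "k' \<in> {1..r} \<rightarrow>\<^sub>E Bij D" and h': "h' \<in> Bij {1..r}"
      and xkh: "x = product_action r D k' h'"
      using G(2) x unfolding wreath_def by blast
    have "c (h' j) \<otimes>\<^bsub>BijGroup D\<^esub> k' j \<otimes>\<^bsub>BijGroup D\<^esub> inv\<^bsub>BijGroup D\<^esub> (c j) \<in> component r D G"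
      if j: "j \<in> {1..r}" for j
    proof -
      have hj: "h' j \<in> {1..r}" by (rule Bij_apply[OF h' j])
      have "k' j \<in> Bij D" using k' j by blast
      then have "c (h' j) \<otimes>\<^bsub>BijGroup D\<^esub> k' j \<otimes>\<^bsub>BijGroup D\<^esub> inv\<^bsub>BijGroup D\<^esub> (c j) =
          inv\<^bsub>BijGroup D\<^esub> (kk (h' j) 1) \<otimes>\<^bsub>BijGroup D\<^esub> (k' j \<otimes>\<^bsub>BijGroup D\<^esub> kk j 1)"
        using kB[OF j] kB[OF hj] j hj D.inv_inv
        by (simp add: c_def D.m_assoc inv_BijGroup_closed)
      then show ?thesis
        using component_transport[OF G D j h' k' _ h[OF j] k[OF j] g[OF j] h1[OF j]
            h[OF hj] k[OF hj] g[OF hj] h1[OF hj]] x xkh by simp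
    qed
    then have "(\<lambda>j\<in>{1..r}. c (h' j) \<otimes>\<^bsub>BijGroup D\<^esub> k' j \<otimes>\<^bsub>BijGroup D\<^esub> inv\<^bsub>BijGroup D\<^esub> (c j))
        \<in> {1..r} \<rightarrow>\<^sub>E component r D G" by simp
    moreover have "h' \<in> top_image r D G" using top_imageI[OF h' k'] x xkh by blast
    ultimately show ?thesis
      unfolding xkh conjugate_product_action(1)[OF c k' h'] wreath_def by blast
  qed
  then show ?thesis using that[OF u] by (auto simp: conjugate_def)
qed

section \<open>Comparison of the orbital digraphs\<close>

text \<open>The inclusion of \<open>G\<close> in \<open>L wr P\<close> may hold only after
  relabelling. The conjuncts therefore treat the literal inclusion, the existence of a relabelling,
  independence of its choice, and the passage from \<open>L\<close> to \<open>T\<close>.\<close>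

theorem theorem17:
  fixes \<Delta> :: "'a set" and r :: nat
    and G :: "((nat \<Rightarrow> 'a) \<Rightarrow> (nat \<Rightarrow> 'a)) set"
    and L T :: "('a \<Rightarrow> 'a) set" and P :: "(nat \<Rightarrow> nat) set"
  assumes "G \<subseteq> wreath r \<Delta> (Bij \<Delta>) (Bij {1..r})"
    and "product_action_type r \<Delta> G"
    and "L = component r \<Delta> G" and "P = top_image r \<Delta> G"
    and "T = socle (perm_group \<Delta> L)"
    and "orbital_digraphs \<Delta> T = orbital_digraphs \<Delta> L"
  shows "(G \<subseteq> wreath r \<Delta> L P \<longrightarrow>
            orbital_digraphs (tuples r \<Delta>) G = orbital_digraphs (tuples r \<Delta>) (wreath r \<Delta> L P))
       \<and> (\<exists>u \<in> relabellings r \<Delta>. conjugate (tuples r \<Delta>) u G \<subseteq> wreath r \<Delta> L P)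
       \<and> (\<forall>u \<in> relabellings r \<Delta>. conjugate (tuples r \<Delta>) u G \<subseteq> wreath r \<Delta> L P \<longrightarrow>
            orbital_digraphs (tuples r \<Delta>) (conjugate (tuples r \<Delta>) u G) =
            orbital_digraphs (tuples r \<Delta>) (wreath r \<Delta> L P))
       \<and> orbital_digraphs (tuples r \<Delta>) (wreath r \<Delta> L P) =
         orbital_digraphs (tuples r \<Delta>) (wreath r \<Delta> T P)"
proof -
  let ?B = "BijGroup \<Delta>" and ?W = "BijGroup (tuples r \<Delta>)"
  note GW = assms(1) and L = assms(3) and P = assms(4)
  interpret B: group ?B by (rule group_BijGroup)
  interpret W: group ?W by (rule group_BijGroup)
  obtain H K where G: "subgroup G ?W" and prim: "primitive_on (tuples r \<Delta>) G" and r2: "r \<ge> 2"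
    and H: "subgroup H (BijGroup {1..r})" and K: "subgroup K ?B"
    and as: "almost_simple (perm_group \<Delta> K)"
    and base: "base_power r \<Delta> (socle (perm_group \<Delta> K)) \<subseteq> G" and GK: "G \<subseteq> wreath r \<Delta> K H"
    using assms(2) unfolding product_action_type_def Let_def by blast
  have r: "1 \<le> r" and 1: "1 \<in> {1..r}" using r2 by auto
  have id: "(\<lambda>i\<in>{1..r}. i) \<in> Bij {1..r}" by (rule id_Bij)
  have KB: "K \<subseteq> Bij \<Delta>" and HB: "H \<subseteq> Bij {1..r}" and GB: "G \<subseteq> Bij (tuples r \<Delta>)"
    using subgroup.subset[OF K] subgroup.subset[OF H] subgroup.subset[OF G] by simp_all
  obtain N where N: "B.socle_witness N K"
    using almost_simple_socle_witness[OF B.group_axioms K as] .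
  have NG: "subgroup N ?B" and NK: "N \<subseteq> K" and N1: "N \<noteq> {\<one>\<^bsub>?B\<^esub>}"
    and Nc: "\<And>x n. x \<in> K \<Longrightarrow> n \<in> N \<Longrightarrow> x \<otimes>\<^bsub>?B\<^esub> n \<otimes>\<^bsub>?B\<^esub> inv\<^bsub>?B\<^esub> x \<in> N"
    using N by (simp_all add: B.socle_witness_def)
  have base: "base_power r \<Delta> N \<subseteq> G"
    using base unfolding B.socle_eq_socle_witness[OF K N] .
  have NB: "N \<subseteq> Bij \<Delta>" using NK KB by blast
  \<comment> \<open>A nonidentity element of \<open>N\<close> moves some point, which gives the two
    points needed for unique decompositions.\<close>
  obtain a b where D: "a \<in> \<Delta>" "b \<in> \<Delta>" "a \<noteq> b"
  proof -
    obtain n where n: "n \<in> N" "n \<noteq> \<one>\<^bsub>?B\<^esub>"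
      using N1 subgroup.one_closed[OF NG] by blast
    have nB: "n \<in> Bij \<Delta>" using n NB by blast
    have "\<exists>d\<in>\<Delta>. n d \<noteq> d"
    proof (rule ccontr)
      assume "\<not> ?thesis"
      then have "n = (\<lambda>d\<in>\<Delta>. d)" by (intro Bij_ext[OF nB id_Bij]) simp
      then show False using n by (simp add: one_BijGroup)
    qed
    then show ?thesis using that Bij_apply[OF nB] by metis
  qed
  have P_sub: "subgroup P (BijGroup {1..r})" unfolding P by (rule subgroup_top_image[OF G])
  then have PB: "P \<subseteq> Bij {1..r}" using subgroup.subset by fastforce
  have L_sub: "subgroup L ?B" unfolding L by (rule subgroup_component[OF G GW r D])
  have LB: "L \<subseteq> Bij \<Delta>" using subgroup.subset[OF L_sub] by simp
  \<comment> \<open>By uniqueness of decompositions, the entries lie in \<open>K\<close> even though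
    \<open>k\<close> was only taken from the symmetric group.\<close>
  have KE: "k \<in> {1..r} \<rightarrow>\<^sub>E K"
    if "k \<in> {1..r} \<rightarrow>\<^sub>E Bij \<Delta>" "h \<in> Bij {1..r}" "product_action r \<Delta> k h \<in> G" for k h
    using wreath_memD(1)[OF _ KB HB D that(2,1)] that(3) GK by blast
  have LK: "L \<subseteq> K"
    unfolding L component_eq[OF GW r D] using KE 1 by blast
  have NL: "N \<subseteq> L"
  proof
    fix n assume n: "n \<in> N"
    let ?n = "\<lambda>i\<in>{1..r}. n"
    have "?n \<in> {1..r} \<rightarrow>\<^sub>E Bij \<Delta>" using n NB by auto
    moreover have "?n \<in> {1..r} \<rightarrow>\<^sub>E N" using n by simp
    then have "product_action r \<Delta> ?n (\<lambda>i\<in>{1..r}. i) \<in> G"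
      using base unfolding base_power_def by blast
    ultimately have "?n 1 \<in> L"
      unfolding L component_eq[OF GW r D] using id 1
      by (intro CollectI exI[of _ ?n] exI[of _ "\<lambda>i\<in>{1..r}. i"]) simp
    then show "n \<in> L" using 1 by simp
  qed
  \<comment> \<open>The component lies between \<open>N\<close> and \<open>K\<close>, so it inherits
    the socle witness.\<close>
  have T: "T = N"
    unfolding assms(5) by (rule B.socle_eq_socle_witness[OF L_sub B.socle_witness_mono[OF N NL LK]])
  \<comment> \<open>The only place where the hypothesis on equal orbital digraphs enters.\<close>
  have TL: "\<exists>t\<in>N. t d = l d \<and> t e = l e" if "l \<in> L" "d \<in> \<Delta>" "e \<in> \<Delta>" for l d e
    using orbital_digraphs_eqD[OF assms(6)[unfolded T] NG L_sub that(2,3,1)] by blast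
  note same_orbitals = orbital_digraphs_wreath[OF L_sub NL PB _ _ _ TL]

  have conj: "orbital_digraphs (tuples r \<Delta>) (conjugate (tuples r \<Delta>) u G) =
      orbital_digraphs (tuples r \<Delta>) (wreath r \<Delta> L P)"
    if u: "u \<in> relabellings r \<Delta>" and sub: "conjugate (tuples r \<Delta>) u G \<subseteq> wreath r \<Delta> L P" for u
  proof -
    obtain c where c: "c \<in> {1..r} \<rightarrow>\<^sub>E Bij \<Delta>" and c1: "c 1 = \<one>\<^bsub>?B\<^esub>"
      and u_eq: "u = product_action r \<Delta> c (\<lambda>i\<in>{1..r}. i)"
      using u by (auto simp: relabellings_def one_BijGroup)
    have uW: "u \<in> carrier ?W" using product_action_Bij[OF id c] by (simp add: u_eq)
    have top: "\<exists>k. k \<in> {1..r} \<rightarrow>\<^sub>E Bij \<Delta> \<and> product_action r \<Delta> k h \<in> G" if "h \<in> P" for h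
      using that by (auto simp: P top_image_def)
    have in_L: "(\<lambda>j\<in>{1..r}. c (h j) \<otimes>\<^bsub>?B\<^esub> k j \<otimes>\<^bsub>?B\<^esub> inv\<^bsub>?B\<^esub> (c j)) \<in> {1..r} \<rightarrow>\<^sub>E L"
      and in_conj: "product_action r \<Delta> (\<lambda>j\<in>{1..r}. c (h j) \<otimes>\<^bsub>?B\<^esub> k j \<otimes>\<^bsub>?B\<^esub> inv\<^bsub>?B\<^esub> (c j)) h
        \<in> conjugate (tuples r \<Delta>) u G"
      if k: "k \<in> {1..r} \<rightarrow>\<^sub>E Bij \<Delta>" and h: "h \<in> Bij {1..r}" and g: "product_action r \<Delta> k h \<in> G"
      for k h
    proof -
      note kc = conjugate_product_action[OF c k h]
      show *: "product_action r \<Delta> (\<lambda>j\<in>{1..r}. c (h j) \<otimes>\<^bsub>?B\<^esub> k j \<otimes>\<^bsub>?B\<^esub> inv\<^bsub>?B\<^esub> (c j)) h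
          \<in> conjugate (tuples r \<Delta>) u G"
        unfolding kc(1)[symmetric] conjugate_def u_eq using g by blast
      show "(\<lambda>j\<in>{1..r}. c (h j) \<otimes>\<^bsub>?B\<^esub> k j \<otimes>\<^bsub>?B\<^esub> inv\<^bsub>?B\<^esub> (c j)) \<in> {1..r} \<rightarrow>\<^sub>E L"
        using wreath_memD(1)[OF _ LB PB D h kc(2)] * sub by blast
    qed
    \<comment> \<open>Take an element of \<open>G\<close> with top part sending \<open>1\<close> to
      \<open>i\<close>. Since \<open>c 1\<close> is the identity, the entry at \<open>1\<close> of
      its conjugate is \<open>c i\<close> times \<open>k 1\<close>. This product lies in
      \<open>L\<close>, hence in \<open>K\<close>, and so does \<open>k 1\<close>.\<close>
    have cK: "c i \<in> K" if i: "i \<in> {1..r}" for i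
    proof -
      obtain h where h: "h \<in> P" "h 1 = i"
        using top_image_transitive[OF G GW prim r D i] unfolding P by blast
      then obtain k where k: "k \<in> {1..r} \<rightarrow>\<^sub>E Bij \<Delta>" and g: "product_action r \<Delta> k h \<in> G"
        using top by blast
      have hB: "h \<in> Bij {1..r}" using h PB by blast
      have k1: "k 1 \<in> K" using KE[OF k hB g] 1 by blast
      have B: "c i \<in> carrier ?B" "k 1 \<in> carrier ?B" using c i k1 KB by auto
      have "c i \<otimes>\<^bsub>?B\<^esub> k 1 \<otimes>\<^bsub>?B\<^esub> inv\<^bsub>?B\<^esub> (c 1) \<in> L"
        using in_L[OF k hB g] 1 h(2) by (auto simp: PiE_iff)
      then have "c i \<otimes>\<^bsub>?B\<^esub> k 1 \<in> L"
        using B by (simp only: c1 B.inv_one B.r_one B.m_closed)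
      then have "c i \<otimes>\<^bsub>?B\<^esub> k 1 \<in> K" using LK by blast
      then have "c i \<otimes>\<^bsub>?B\<^esub> k 1 \<otimes>\<^bsub>?B\<^esub> inv\<^bsub>?B\<^esub> (k 1) \<in> K"
        using subgroup.m_closed[OF K] subgroup.m_inv_closed[OF K k1] by blast
      then show ?thesis using B by (simp only: B.m_assoc B.inv_closed B.r_inv B.r_one)
    qed
    \<comment> \<open>Normality of \<open>N\<close> in \<open>K\<close>, applied to the inverse of
      \<open>c j\<close>.\<close>
    have cN: "inv\<^bsub>?B\<^esub> (c j) \<otimes>\<^bsub>?B\<^esub> n \<otimes>\<^bsub>?B\<^esub> c j \<in> N" if "j \<in> {1..r}" "n \<in> N" for j n
    proof -
      have "c j \<in> carrier ?B" using cK[OF that(1)] KB by auto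
      then show ?thesis
        using Nc[OF subgroup.m_inv_closed[OF K cK[OF that(1)]] that(2)] by (simp only: B.inv_inv)
    qed
    show ?thesis
    proof (rule same_orbitals[OF sub])
      fix h assume h: "h \<in> P"
      then obtain k where k: "k \<in> {1..r} \<rightarrow>\<^sub>E Bij \<Delta>" and g: "product_action r \<Delta> k h \<in> G"
        using top by blast
      have hB: "h \<in> Bij {1..r}" using h PB by blast
      show "\<exists>k \<in> {1..r} \<rightarrow>\<^sub>E L. product_action r \<Delta> k h \<in> conjugate (tuples r \<Delta>) u G"
        using in_L[OF k hB g] in_conj[OF k hB g] by blast
    next
      fix t x assume t: "t \<in> base_power r \<Delta> N" and "x \<in> conjugate (tuples r \<Delta>) u G"
      then obtain g where g: "g \<in> G" and x: "x = u \<otimes>\<^bsub>?W\<^esub> g \<otimes>\<^bsub>?W\<^esub> inv\<^bsub>?W\<^esub> u"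
        by (auto simp: conjugate_def)
      obtain t' where t': "t' \<in> base_power r \<Delta> N" and tu: "t \<otimes>\<^bsub>?W\<^esub> u = u \<otimes>\<^bsub>?W\<^esub> t'"
        using base_power_mult_commute[OF NB c cN t] unfolding u_eq by blast
      have W: "t \<in> carrier ?W" "t' \<in> carrier ?W" "g \<in> carrier ?W"
        using t t' g base GB by auto
      have "t' \<otimes>\<^bsub>?W\<^esub> g \<in> G" using subgroup.m_closed[OF G] t' base g by blast
      moreover have "t \<otimes>\<^bsub>?W\<^esub> x = u \<otimes>\<^bsub>?W\<^esub> (t' \<otimes>\<^bsub>?W\<^esub> g) \<otimes>\<^bsub>?W\<^esub> inv\<^bsub>?W\<^esub> u"
      proof -
        have "t \<otimes>\<^bsub>?W\<^esub> x = (t \<otimes>\<^bsub>?W\<^esub> u) \<otimes>\<^bsub>?W\<^esub> g \<otimes>\<^bsub>?W\<^esub> inv\<^bsub>?W\<^esub> u"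
          unfolding x using W uW by (simp only: W.m_assoc W.m_closed W.inv_closed)
        then show ?thesis
          unfolding tu using W uW by (simp only: W.m_assoc W.m_closed W.inv_closed)
      qed
      ultimately show "t \<otimes>\<^bsub>?W\<^esub> x \<in> conjugate (tuples r \<Delta>) u G"
        unfolding conjugate_def by blast
    qed
  qed

  \<comment> \<open>The case of the trivial relabelling.\<close>
  have "G \<subseteq> wreath r \<Delta> L P \<Longrightarrow>
      orbital_digraphs (tuples r \<Delta>) G = orbital_digraphs (tuples r \<Delta>) (wreath r \<Delta> L P)"
    using conj[OF one_relabelling[OF r]] unfolding conjugate_one[OF GB] .
  moreover have "\<exists>u \<in> relabellings r \<Delta>. conjugate (tuples r \<Delta>) u G \<subseteq> wreath r \<Delta> L P"
    using conjugate_subset_wreath[OF G GW prim r D] unfolding L P by blast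
  moreover have "orbital_digraphs (tuples r \<Delta>) (wreath r \<Delta> N P) =
      orbital_digraphs (tuples r \<Delta>) (wreath r \<Delta> L P)"
  \<comment> \<open>Now \<open>X\<close> is \<open>N wr P\<close>; every \<open>h\<close> in
    \<open>P\<close> is covered by the element whose base entries are all the identity.\<close>
  proof (rule same_orbitals)
    show "wreath r \<Delta> N P \<subseteq> wreath r \<Delta> L P" by (rule wreath_mono[OF NL order_refl])
    fix h assume "h \<in> P"
    moreover have "(\<lambda>j\<in>{1..r}. \<one>\<^bsub>?B\<^esub>) \<in> {1..r} \<rightarrow>\<^sub>E N"
      using subgroup.one_closed[OF NG] by auto
    ultimately show "\<exists>k \<in> {1..r} \<rightarrow>\<^sub>E L. product_action r \<Delta> k h \<in> wreath r \<Delta> N P"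
      using NL unfolding wreath_def by blast
  next
    fix t g assume "t \<in> base_power r \<Delta> N" and "g \<in> wreath r \<Delta> N P"
    then obtain n k h where n: "n \<in> {1..r} \<rightarrow>\<^sub>E N" and t: "t = product_action r \<Delta> n (\<lambda>i\<in>{1..r}. i)"
      and k: "k \<in> {1..r} \<rightarrow>\<^sub>E N" and h: "h \<in> P" and g: "g = product_action r \<Delta> k h"
      by (auto simp: base_power_def elim!: wreathE)
    have hB: "h \<in> Bij {1..r}" using h PB by blast
    have nB: "n \<in> {1..r} \<rightarrow>\<^sub>E Bij \<Delta>" "k \<in> {1..r} \<rightarrow>\<^sub>E Bij \<Delta>" using n k NB by blast+
    have "(\<lambda>i\<in>{1..r}. i) \<otimes>\<^bsub>BijGroup {1..r}\<^esub> h \<in> P"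
      using subgroup.m_closed[OF P_sub subgroup.one_closed[OF P_sub] h] by (simp only: one_BijGroup)
    moreover have "n (h j) \<otimes>\<^bsub>?B\<^esub> k j \<in> N" if "j \<in> {1..r}" for j
      using n k that Bij_apply[OF hB that] by (intro subgroup.m_closed[OF NG]) blast+
    then have "(\<lambda>j\<in>{1..r}. n (h j) \<otimes>\<^bsub>?B\<^esub> k j) \<in> {1..r} \<rightarrow>\<^sub>E N" by simp
    ultimately show "t \<otimes>\<^bsub>?W\<^esub> g \<in> wreath r \<Delta> N P"
      unfolding t g product_action_mult[OF hB nB(2) id nB(1)] wreath_def by blast
  qed
  ultimately show ?thesis using conj unfolding T by auto
qed

end
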